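(* Let $B$ be a PSIT, $H\in\mathfrak M^B$ and $A\in\mathfrak V^B$. If $H$ is integrable on $B$ w.r.t. $A$, then: (1) $(H_\bullet A)I_{[\![0]\!]}=HAI_{[\![0]\!]}$ and $\Delta(H_\bullet A)=H\,\Delta A$. (2) For any stopping time $\tau$ on $B$, $$(H_\bullet A)^\tau\mathfrak I_B=H_\bullet(A^\tau\mathfrak I_B)=(H^\tau\mathfrak I_B)_\bullet(A^\tau\mathfrak I_B)=(HI_{[\![0,\tau]\!]}\mathfrak I_B)_\bullet A.$$
   Context: Fix a probability space $(\Omega,\mathcal F,\mathbb P)$ with a filtration $\mathbb F=(\mathcal F_t)_{t\ge0}$ satisfying the usual conditions; $\mathbb R^+=[0,+\infty[$, $\mathbb N^+=\{1,2,\dots\}$. A process is a family of real random variables indexed by $\mathbb R^+$; indistinguishable processes are regarded as the same ($X=Y$ means indistinguishability). For stopping times $S,T$, $[\![S,T]\!]=\{(\omega,t)\in\Omega\times\mathbb R^+:S(\omega)\le t\le T(\omega)\}$; $[\![S,T[\![$, $]\!]S,T]\!]$, $]\!]S,T[\![$ are defined analogously with strict inequality at open ends; $[\![T]\!]=[\![T,T]\!]$. $T_n\uparrow T$ means that $(T_n)$ is an increasing sequence of stopping times with limit $T$. Juxtaposition of sets means intersection. If $X$ is a real function on $\widetilde C\subseteq\Omega\times\mathbb R^+$, then $XI_C$ is the function on $\Omega\times\mathbb R^+$ equal to $X$ on $C\cap\widetilde C$ and $0$ elsewhere. A set $B\subseteq\Omega\times\mathbb R^+$ is a predictable set of interval type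 (PSIT) if it is predictable and there is a non-negative (possibly infinite) random variable $T$ such that each section $B_\omega=\{t:(\omega,t)\in B\}$ is nonempty and equals $[0,T(\omega)[$ or $[0,T(\omega)]$. The debut of $B^c$ is $\omega\mapsto\inf\{t:(\omega,t)\notin B\}$. A process on $B$ is a real function $X$ on $B$ such that $XI_B$ is a process; processes $X,Y$ on $B$ are identified ($X=Y$) if $XI_B=YI_B$. For $X$ defined on a set containing $B$, $X\mathfrak I_B$ is its restriction to $B$. A stopping time $\tau$ is a stopping time on $B$ if $[\![0,\tau]\!]\subseteq B$; then for a process $X$ on $B$, $X^\tau:=XI_{[\![0,\tau]\!]}+X_\tau I_{]\!]\tau,+\infty[\![}$ (a process on $\Omega\times\mathbb R^+$). Let $T$ be the debut of $B^c$. A coupled sequence (CS) for a process $X$ on $B$ is a sequence $(T_n,X^{(n)})_{n\in\mathbb N^+}$ with $T_n$ stopping times, $T_n\uparrow T$, $\bigcup_n[\![0,T_n]\!]\supseteq B$, $X^{(n)}$ processes, and $XI_{B[\![0,T_n]\!]}=X^{(n)}I_{B[\![0,T_n]\!]}$ for each $n$. For a class $\mathcal D$ of processes, $\mathcal D^B$ is the set of processes $X$ on $B$ having a CS with all $X^{(n)}\in\mathcal D$. For a process $X$ on $B$ locally c\`adl\`ag in this sense, $X_-(\omega,0)=X(\omega,0)$, $X_-(\omega,t)=\lim_{s<t,s\uparrow t}X(\omega,s)$ for $(\omega,t)\in B$, $t>0$, and $\Delta X=X-X_-$. $\mathfrak M$ is the class of all measurable processes and $\mathfrak V$ the class of all (not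 necessarily adapted) processes with finite variation (c\`adl\`ag paths, of finite variation on bounded intervals). Pathwise integrals over $[0,t]$ include the mass at $0$: $\int_{[0,t]}H_s\,dA_s=H_0A_0+\int_{]0,t]}H_s\,dA_s$, and $\int_{[0,t]}|dA_s|$ is the variation process of $A$ (including $|A_0|$). For $H\in\mathfrak M^B$, $A\in\mathfrak V^B$, $H$ is integrable on $B$ w.r.t. $A$ if $\int_{[0,t]}|H_s(\omega)||dA_s(\omega)|<+\infty$ for all $(\omega,t)\in B$, and then $H_\bullet A$ is the process on $B$ given by $(H_\bullet A)(\omega,t)=\int_{[0,t]}H_s(\omega)\,dA_s(\omega)$, $(\omega,t)\in B$. The equalities in the claim include the assertion that the integrals involved exist. *)

theory Defs
  imports "HOL-Probability.Probability"
begin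

section \<open>Filtered probability spaces, processes, stopping times\<close>

text \<open>
  Time is \<^typ>\<open>real\<close> restricted to nonnegative values; \<open>F t\<close> is irrelevant for \<open>t < 0\<close>.
  Random times take values in \<open>[0, \<infinity>]\<close>, i.e. in \<^typ>\<open>ennreal\<close>.
\<close>

locale usual_filtration = prob_space M for M :: "'a measure" +
  fixes F :: "real \<Rightarrow> 'a measure"
  assumes subalgebra_F: "0 \<le> t \<Longrightarrow> subalgebra M (F t)"
    and mono_F: "0 \<le> s \<Longrightarrow> s \<le> t \<Longrightarrow> sets (F s) \<subseteq> sets (F t)"
    and right_continuous_F: "0 \<le> t \<Longrightarrow> sets (F t) = (\<Inter>s\<in>{t<..}. sets (F s))"
    and complete_F: "N \<in> null_sets M \<Longrightarrow> A \<subseteq> N \<Longrightarrow> A \<in> sets (F 0)"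

text \<open>
  \<^const>\<open>stopping_time\<close> wants times and time index of the same type, so the filtration is
  re-indexed by \<open>[0, \<infinity>]\<close>. The index \<open>\<infinity>\<close> imposes no condition on a stopping time,
  since \<open>T \<le> \<infinity>\<close> always holds.
\<close>

definition extend_filtration :: "'a measure \<Rightarrow> (real \<Rightarrow> 'a measure) \<Rightarrow> ennreal \<Rightarrow> 'a measure" where
  "extend_filtration M F t = (if t = top then M else F (enn2real t))"

definition is_stopping_time :: "'a measure \<Rightarrow> (real \<Rightarrow> 'a measure) \<Rightarrow> ('a \<Rightarrow> ennreal) \<Rightarrow> bool" where
  "is_stopping_time M F T \<longleftrightarrow> stopping_time (extend_filtration M F) T"

definition stoch_Icc :: "'a measure \<Rightarrow> ('a \<Rightarrow> ennreal) \<Rightarrow> ('a \<Rightarrow> ennreal) \<Rightarrow> ('a \<times> real) set" where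
  "stoch_Icc M S T = {(\<omega>, t). \<omega> \<in> space M \<and> 0 \<le> t \<and> S \<omega> \<le> ennreal t \<and> ennreal t \<le> T \<omega>}"

definition process :: "'a measure \<Rightarrow> ('a \<times> real \<Rightarrow> real) \<Rightarrow> bool" where
  "process M X \<longleftrightarrow> (\<forall>t\<ge>0. (\<lambda>\<omega>. X (\<omega>, t)) \<in> borel_measurable M)"

definition indistinguishable ::
  "'a measure \<Rightarrow> ('a \<times> real \<Rightarrow> real) \<Rightarrow> ('a \<times> real \<Rightarrow> real) \<Rightarrow> bool" where
  "indistinguishable M X Y \<longleftrightarrow> (AE \<omega> in M. \<forall>t\<ge>0. X (\<omega>, t) = Y (\<omega>, t))"

text \<open>The function \<open>X I\<^sub>C\<close>; it is only used for sets \<open>C\<close> contained in the domain of \<open>X\<close>.\<close>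

definition cut :: "('a \<times> real \<Rightarrow> real) \<Rightarrow> ('a \<times> real) set \<Rightarrow> 'a \<times> real \<Rightarrow> real" where
  "cut X C = (\<lambda>p. if p \<in> C then X p else 0)"

section \<open>Predictable sets of interval type\<close>

definition predictable_sigma :: "'a measure \<Rightarrow> (real \<Rightarrow> 'a measure) \<Rightarrow> ('a \<times> real) measure" where
  "predictable_sigma M F = sigma (space M \<times> {0..})
     ({C \<times> {0} | C. C \<in> sets (F 0)} \<union>
      {C \<times> {s<..t} | C s t. 0 \<le> s \<and> s \<le> t \<and> C \<in> sets (F s)})"

definition PSIT :: "'a measure \<Rightarrow> (real \<Rightarrow> 'a measure) \<Rightarrow> ('a \<times> real) set \<Rightarrow> bool" where
  "PSIT M F B \<longleftrightarrow> B \<in> sets (predictable_sigma M F) \<and>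
     (\<exists>T :: 'a \<Rightarrow> ennreal. T \<in> borel_measurable M \<and>
        (\<forall>\<omega>\<in>space M. {t. (\<omega>, t) \<in> B} \<noteq> {} \<and>
           ({t. (\<omega>, t) \<in> B} = {t. 0 \<le> t \<and> ennreal t < T \<omega>} \<or>
            {t. (\<omega>, t) \<in> B} = {t. 0 \<le> t \<and> ennreal t \<le> T \<omega>})))"

definition debut_compl :: "('a \<times> real) set \<Rightarrow> 'a \<Rightarrow> ennreal" where
  "debut_compl B \<omega> = Inf {ennreal t | t. 0 \<le> t \<and> (\<omega>, t) \<notin> B}"

section \<open>Processes on a set\<close>

text \<open>
  A real function on \<open>B\<close> is rendered as a total function whose values outside \<open>B\<close> are immaterial;
  restriction to \<open>B\<close> is \<^const>\<open>restrict\<close>.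
\<close>

definition process_on :: "'a measure \<Rightarrow> ('a \<times> real) set \<Rightarrow> ('a \<times> real \<Rightarrow> real) \<Rightarrow> bool" where
  "process_on M B X \<longleftrightarrow> process M (cut X B)"

definition eq_on ::
  "'a measure \<Rightarrow> ('a \<times> real) set \<Rightarrow> ('a \<times> real \<Rightarrow> real) \<Rightarrow> ('a \<times> real \<Rightarrow> real) \<Rightarrow> bool" where
  "eq_on M B X Y \<longleftrightarrow> indistinguishable M (cut X B) (cut Y B)"

definition stopping_time_on ::
  "'a measure \<Rightarrow> (real \<Rightarrow> 'a measure) \<Rightarrow> ('a \<times> real) set \<Rightarrow> ('a \<Rightarrow> ennreal) \<Rightarrow> bool" where
  "stopping_time_on M F B \<tau> \<longleftrightarrow> is_stopping_time M F \<tau> \<and> stoch_Icc M (\<lambda>_. 0) \<tau> \<subseteq> B"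

definition stopped :: "('a \<Rightarrow> ennreal) \<Rightarrow> ('a \<times> real \<Rightarrow> real) \<Rightarrow> 'a \<times> real \<Rightarrow> real" where
  "stopped \<tau> X = (\<lambda>(\<omega>, t). if ennreal t \<le> \<tau> \<omega> then X (\<omega>, t) else X (\<omega>, enn2real (\<tau> \<omega>)))"

definition coupled_sequence ::
  "'a measure \<Rightarrow> (real \<Rightarrow> 'a measure) \<Rightarrow> ('a \<times> real) set \<Rightarrow> ('a \<times> real \<Rightarrow> real) \<Rightarrow>
   (nat \<Rightarrow> 'a \<Rightarrow> ennreal) \<Rightarrow> (nat \<Rightarrow> 'a \<times> real \<Rightarrow> real) \<Rightarrow> bool" where
  "coupled_sequence M F B X T Y \<longleftrightarrow>
     (\<forall>n. is_stopping_time M F (T n)) \<and>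
     (\<forall>\<omega>\<in>space M. incseq (\<lambda>n. T n \<omega>) \<and> (\<lambda>n. T n \<omega>) \<longlonglongrightarrow> debut_compl B \<omega>) \<and>
     B \<subseteq> (\<Union>n. stoch_Icc M (\<lambda>_. 0) (T n)) \<and>
     (\<forall>n. process M (Y n) \<and>
       indistinguishable M (cut X (B \<inter> stoch_Icc M (\<lambda>_. 0) (T n)))
                           (cut (Y n) (B \<inter> stoch_Icc M (\<lambda>_. 0) (T n))))"

text \<open>The class \<open>D\<^sup>B\<close>.\<close>

definition localized ::
  "'a measure \<Rightarrow> (real \<Rightarrow> 'a measure) \<Rightarrow> ('a \<times> real) set \<Rightarrow> ('a \<times> real \<Rightarrow> real) set \<Rightarrow>
   ('a \<times> real \<Rightarrow> real) set" where
  "localized M F B D =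
     {X. process_on M B X \<and> (\<exists>T Y. coupled_sequence M F B X T Y \<and> (\<forall>n. Y n \<in> D))}"

text \<open>
  Existence of the left limits on \<open>B\<close>. \<^const>\<open>Lim\<close> in \<open>left_lim\<close> below returns an unspecified
  value when the limit does not exist.
\<close>

definition has_left_limits_on :: "'a measure \<Rightarrow> ('a \<times> real) set \<Rightarrow> ('a \<times> real \<Rightarrow> real) \<Rightarrow> bool" where
  "has_left_limits_on M B X \<longleftrightarrow>
     (AE \<omega> in M. \<forall>t>0. (\<omega>, t) \<in> B \<longrightarrow> (\<exists>l. ((\<lambda>s. X (\<omega>, s)) \<longlongrightarrow> l) (at_left t)))"

definition left_lim :: "('a \<times> real \<Rightarrow> real) \<Rightarrow> 'a \<times> real \<Rightarrow> real" where
  "left_lim X = (\<lambda>(\<omega>, t). if t = 0 then X (\<omega>, 0) else Lim (at_left t) (\<lambda>s. X (\<omega>, s)))"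

definition jump :: "('a \<times> real \<Rightarrow> real) \<Rightarrow> 'a \<times> real \<Rightarrow> real" where
  "jump X = (\<lambda>p. X p - left_lim X p)"

section \<open>Measurable processes and processes of finite variation\<close>

definition measurable_processes :: "'a measure \<Rightarrow> ('a \<times> real \<Rightarrow> real) set" where
  "measurable_processes M = borel_measurable (M \<Otimes>\<^sub>M restrict_space borel {0..})"

definition variation :: "(real \<Rightarrow> real) \<Rightarrow> real set \<Rightarrow> ennreal" where
  "variation f S = (SUP xs\<in>{xs. sorted xs \<and> set xs \<subseteq> S}.
     \<Sum>i<length xs - 1. ennreal \<bar>f (xs ! Suc i) - f (xs ! i)\<bar>)"

definition cadlag :: "(real \<Rightarrow> real) \<Rightarrow> bool" where
  "cadlag f \<longleftrightarrow> (\<forall>t\<ge>0. (f \<longlongrightarrow> f t) (at_right t)) \<and> (\<forall>t>0. \<exists>l. (f \<longlongrightarrow> l) (at_left t))"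

definition fv_processes :: "'a measure \<Rightarrow> ('a \<times> real \<Rightarrow> real) set" where
  "fv_processes M = {X. process M X \<and>
     (\<forall>\<omega>\<in>space M. cadlag (\<lambda>t. X (\<omega>, t)) \<and> (\<forall>t\<ge>0. variation (\<lambda>s. X (\<omega>, s)) {0..t} < top))}"

section \<open>Pathwise Lebesgue--Stieltjes integrals\<close>

text \<open>
  Integrals over \<open>[0, t]\<close> use only the values of the integrator \<open>a\<close> on \<open>[0, t]\<close>:
  \<open>a\<close> is continued constantly to the left of \<open>0\<close> and to the right of \<open>t\<close>. The signed measure
  \<open>da\<close> on \<open>]0, t]\<close> is the difference of the measures induced by the nondecreasing functions
  \<open>(V + a) / 2\<close> and \<open>(V - a) / 2\<close>, where \<open>V\<close> is the variation function of the continued \<open>a\<close>,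
  and \<open>|da|\<close> is the measure induced by \<open>V\<close>. The mass at \<open>0\<close> is added separately.
\<close>

definition ext_path :: "real \<Rightarrow> (real \<Rightarrow> real) \<Rightarrow> real \<Rightarrow> real" where
  "ext_path t a s = a (max 0 (min s t))"

definition var_path :: "real \<Rightarrow> (real \<Rightarrow> real) \<Rightarrow> real \<Rightarrow> real" where
  "var_path t a s = enn2real (variation (ext_path t a) {0..s})"

definition LS_integral :: "real \<Rightarrow> (real \<Rightarrow> real) \<Rightarrow> (real \<Rightarrow> real) \<Rightarrow> real" where
  "LS_integral t h a = h 0 * a 0 +
     ((LINT s:{0<..t}|interval_measure (\<lambda>u. (var_path t a u + ext_path t a u) / 2). h s) -
      (LINT s:{0<..t}|interval_measure (\<lambda>u. (var_path t a u - ext_path t a u) / 2). h s))"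

definition LS_abs_integral :: "real \<Rightarrow> (real \<Rightarrow> real) \<Rightarrow> (real \<Rightarrow> real) \<Rightarrow> ennreal" where
  "LS_abs_integral t h a = ennreal (\<bar>h 0\<bar> * \<bar>a 0\<bar>) +
     (\<integral>\<^sup>+s\<in>{0<..t}. ennreal \<bar>h s\<bar> \<partial>interval_measure (var_path t a))"

definition integrable_on_wrt ::
  "'a measure \<Rightarrow> (real \<Rightarrow> 'a measure) \<Rightarrow> ('a \<times> real) set \<Rightarrow>
   ('a \<times> real \<Rightarrow> real) \<Rightarrow> ('a \<times> real \<Rightarrow> real) \<Rightarrow> bool" where
  "integrable_on_wrt M F B H A \<longleftrightarrow>
     H \<in> localized M F B (measurable_processes M) \<and> A \<in> localized M F B (fv_processes M) \<and>
     (AE \<omega> in M. \<forall>t. (\<omega>, t) \<in> B \<longrightarrow>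
        LS_abs_integral t (\<lambda>s. H (\<omega>, s)) (\<lambda>s. A (\<omega>, s)) < top)"

definition LS_process ::
  "('a \<times> real) set \<Rightarrow> ('a \<times> real \<Rightarrow> real) \<Rightarrow> ('a \<times> real \<Rightarrow> real) \<Rightarrow> 'a \<times> real \<Rightarrow> real" where
  "LS_process B H A = (\<lambda>(\<omega>, t)\<in>B. LS_integral t (\<lambda>s. H (\<omega>, s)) (\<lambda>s. A (\<omega>, s)))"

end

theory Submission
  imports Defs
begin

text \<open>
  Everything is pathwise. For almost every \<open>\<omega>\<close> and every \<open>t\<close> with \<open>(\<omega>, t) \<in> B\<close>, the coupled
  sequences show that on \<open>[0, t]\<close> the path of \<open>A\<close> is cadlag of finite variation and that of \<open>H\<close> is
  Borel. The variation function of a right-continuous path is right-continuous, so the measures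
  defining the integral over \<open>]0, s]\<close> are determined there by the increments of the path on \<open>[0, s]\<close>
  and do not depend on the horizon \<open>t \<ge> s\<close>. Dominated convergence then yields the left limits of
  \<open>H\<^sub>\<bullet>A\<close>, and the atom at \<open>t\<close> its jump; stopping the integrator removes the mass of \<open>]\<tau>, t]\<close>,
  which makes all four integrals of part (2) equal to the integral over \<open>[0, t \<and> \<tau>]\<close>.
\<close>

section \<open>Variation of paths\<close>

text \<open>Two obstacles shape the proof. \<open>LS_integral t\<close> builds its measures from the
  path frozen at \<open>t\<close>, so every horizon has its own pair of measures. They are compared
  through increments, and \<open>interval_measure\<close> gives half-open intervals the increments
  of a function that is nondecreasing and right-continuous; this is why right-continuity of the
  variation comes first. The second obstacle is the existence claim: it includes that the stopped
  and cut processes again have coupled sequences in the right class. Members of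
  \<open>fv_processes\<close> are measurable at fixed times by definition, so their values at a
  random time are obtained from right-continuity, and measurability of a process on \<open>B\<close>
  is recovered from a coupled sequence by completeness of the filtration. A coupled sequence brings
  only countably many null sets, so a single one serves every \<open>t\<close>.\<close>

fun path_sum :: "(real \<Rightarrow> real) \<Rightarrow> real list \<Rightarrow> ennreal" where
  "path_sum f (x # y # zs) = ennreal \<bar>f y - f x\<bar> + path_sum f (y # zs)"
| "path_sum f _ = 0"

text \<open>The recursive form lets points be inserted and lists be joined by induction, without the
  indices that occur in \<open>variation\<close>.\<close>

lemma path_sum_eq_sum:
  "path_sum f xs = (\<Sum>i<length xs - 1. ennreal \<bar>f (xs ! Suc i) - f (xs ! i)\<bar>)"
proof (induction f xs rule: path_sum.induct)
  case (1 f x y zs)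
  then show ?case
    by (simp add: sum.lessThan_Suc_shift del: sum.lessThan_Suc sum_ennreal)
qed auto

lemma variation_eq_path_sum:
  "variation f S = (SUP xs\<in>{xs. sorted xs \<and> set xs \<subseteq> S}. path_sum f xs)"
  unfolding variation_def path_sum_eq_sum ..

lemma path_sum_le_variation: "sorted xs \<Longrightarrow> set xs \<subseteq> S \<Longrightarrow> path_sum f xs \<le> variation f S"
  unfolding variation_eq_path_sum by (intro SUP_upper) auto

lemma variation_le:
  "(\<And>xs. sorted xs \<Longrightarrow> set xs \<subseteq> S \<Longrightarrow> path_sum f xs \<le> c) \<Longrightarrow> variation f S \<le> c"
  unfolding variation_eq_path_sum by (intro SUP_least) auto

lemma path_sum_cong: "(\<And>x. x \<in> set xs \<Longrightarrow> f x = g x) \<Longrightarrow> path_sum f xs = path_sum g xs"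
  by (induction f xs rule: path_sum.induct) auto

lemma variation_cong: "(\<And>x. x \<in> S \<Longrightarrow> f x = g x) \<Longrightarrow> variation f S = variation g S"
  unfolding variation_eq_path_sum by (intro SUP_cong refl path_sum_cong) auto

lemma variation_mono: "S \<subseteq> S' \<Longrightarrow> variation f S \<le> variation f S'"
  by (intro variation_le path_sum_le_variation) auto

lemma variation_const [simp]: "variation (\<lambda>_. c) S = 0"
proof -
  have "path_sum (\<lambda>_. c) xs = 0" for xs
    by (induction "\<lambda>_::real. c" xs rule: path_sum.induct) auto
  then have "variation (\<lambda>_. c) S \<le> 0"
    by (intro variation_le) simp
  then show ?thesis by simp
qed

lemma path_sum_tl_le: "path_sum f ys \<le> path_sum f (x # ys)"
  by (cases ys) auto

lemma abs_diff_triangle_ennreal: "ennreal \<bar>a - c\<bar> \<le> ennreal \<bar>a - b\<bar> + ennreal \<bar>b - c\<bar>" for a b c :: real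
  by (simp flip: ennreal_plus add: ennreal_leI)

lemma path_sum_replace_hd: "path_sum f (x # ys) \<le> ennreal \<bar>f v - f x\<bar> + path_sum f (v # ys)"
proof (cases ys)
  case (Cons y zs)
  have "ennreal \<bar>f y - f x\<bar> \<le> ennreal \<bar>f v - f x\<bar> + ennreal \<bar>f y - f v\<bar>"
    using abs_diff_triangle_ennreal[of "f y" "f x" "f v"] by (simp add: add.commute)
  then show ?thesis
    using Cons add_right_mono by (simp add: add.assoc[symmetric])
qed auto

lemma path_sum_append: "path_sum f (xs @ v # ys) = path_sum f (xs @ [v]) + path_sum f (v # ys)"
  by (induction f xs rule: path_sum.induct) (auto simp: add.assoc)

text \<open>This is the triangle inequality between the neighbours of \<open>v\<close>, or the
  positivity of a new summand when \<open>v\<close> is put at an end. It lets a division point be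
  added to any list of partition points.\<close>

lemma path_sum_insert_le: "path_sum f (xs @ ys) \<le> path_sum f (xs @ v # ys)"
proof (induction f xs rule: path_sum.induct)
  case ("2_2" f x)
  then show ?case
    using path_sum_replace_hd[of f x ys v] by simp
qed (auto simp: path_sum_tl_le add_left_mono)

text \<open>Adding \<open>b\<close> to a partition of \<open>{a..c}\<close> does not lower its sum
  and cuts it into partitions of the two halves; conversely, partitions of the halves are glued at
  \<open>b\<close>.\<close>

lemma variation_Icc_split:
  assumes "a \<le> b" "b \<le> c"
  shows "variation f {a..c} = variation f {a..b} + variation f {b..c}"
proof (rule antisym)
  show "variation f {a..c} \<le> variation f {a..b} + variation f {b..c}"
  proof (rule variation_le)
    fix xs :: "real list" assume xs: "sorted xs" "set xs \<subseteq> {a..c}"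
    define ys zs where "ys = takeWhile (\<lambda>x. x \<le> b) xs" and "zs = dropWhile (\<lambda>x. x \<le> b) xs"
    have eq: "xs = ys @ zs" unfolding ys_def zs_def by simp
    have ysb: "\<forall>y\<in>set ys. y \<le> b" unfolding ys_def by (auto dest: set_takeWhileD)
    have zsb: "\<forall>z\<in>set zs. b \<le> z"
    proof (cases zs)
      case (Cons z us)
      have "\<not> z \<le> b" using Cons unfolding zs_def by (simp add: dropWhile_eq_Cons_conv)
      moreover have "\<forall>u\<in>set zs. z \<le> u" using xs(1) eq Cons by (auto simp: sorted_append)
      ultimately show ?thesis by force
    qed auto
    have "sorted ys" "sorted zs" using xs(1) eq by (auto simp: sorted_append)
    then have "path_sum f (ys @ [b]) \<le> variation f {a..b}" "path_sum f (b # zs) \<le> variation f {b..c}"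
      using ysb zsb xs(2) eq assms by (auto intro!: path_sum_le_variation simp: sorted_append subset_iff)
    then show "path_sum f xs \<le> variation f {a..b} + variation f {b..c}"
      using path_sum_insert_le[of f ys zs b] path_sum_append[of f ys b zs] eq
      by (metis add_mono order_trans)
  qed
  have *: "path_sum f xs + path_sum f ys \<le> variation f {a..c}"
    if "sorted xs" "set xs \<subseteq> {a..b}" "sorted ys" "set ys \<subseteq> {b..c}" for xs ys
  proof -
    have "path_sum f xs + path_sum f ys \<le> path_sum f (xs @ [b]) + path_sum f (b # ys)"
      using path_sum_insert_le[of f xs "[]" b] by (intro add_mono path_sum_tl_le) simp
    also have "\<dots> = path_sum f (xs @ b # ys)" by (rule path_sum_append[symmetric])
    also have "\<dots> \<le> variation f {a..c}"
    proof (rule path_sum_le_variation)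
      have "x \<le> b" if "x \<in> set xs" for x using that \<open>set xs \<subseteq> {a..b}\<close> by auto
      moreover have "b \<le> y" if "y \<in> set ys" for y using that \<open>set ys \<subseteq> {b..c}\<close> by auto
      ultimately show "sorted (xs @ b # ys)"
        using \<open>sorted xs\<close> \<open>sorted ys\<close> by (auto simp: sorted_append intro: order_trans)
      show "set (xs @ b # ys) \<subseteq> {a..c}"
        using \<open>set xs \<subseteq> {a..b}\<close> \<open>set ys \<subseteq> {b..c}\<close> assms by (auto simp: subset_iff intro: order_trans)
    qed
    finally show ?thesis .
  qed
  have ne: "{xs. sorted xs \<and> set xs \<subseteq> S} \<noteq> {}" for S :: "real set"
    by (auto intro!: exI[of _ "[]"])
  \<comment> \<open>The two suprema are taken in turn: over the lists in \<open>{b..c}\<close> for a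
    fixed \<open>xs\<close>, then over \<open>xs\<close>.\<close>
  have "path_sum f xs + variation f {b..c} \<le> variation f {a..c}"
    if "sorted xs" "set xs \<subseteq> {a..b}" for xs
    unfolding variation_eq_path_sum[of f "{b..c}"] ennreal_SUP_add_right[OF ne]
    by (rule SUP_least) (use that * in blast)
  then show "variation f {a..b} + variation f {b..c} \<le> variation f {a..c}"
    unfolding variation_eq_path_sum[of f "{a..b}"] ennreal_SUP_add_left[OF ne, symmetric]
    by (intro SUP_least) blast
qed

lemma variation_singleton [simp]: "variation f {a} = 0"
  using variation_cong[of "{a}" f "\<lambda>_. f a"] by simp

lemma variation_empty [simp]: "variation f {} = 0"
  using variation_mono[of "{}" "{0}" f] by simp

lemma abs_diff_le_variation: "a \<le> b \<Longrightarrow> ennreal \<bar>f b - f a\<bar> \<le> variation f {a..b}"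
  using path_sum_le_variation[of "[a, b]" "{a..b}" f] by simp

text \<open>
  A list of points in \<open>{u..w}\<close> that nearly attains the variation can be started at a point \<open>v\<close>
  just right of \<open>u\<close> at a small cost, so that little variation is left for \<open>{u..v}\<close>.
\<close>

lemma variation_small_right:
  assumes cont: "continuous (at_right u) f" and uw: "u < w" and fin: "variation f {u..w} < top"
    and e: "0 < (e::real)"
  shows "\<exists>v>u. v \<le> w \<and> variation f {u..v} \<le> ennreal e"
proof -
  \<comment> \<open>Half of \<open>e\<close> allows the sum to fall short of the variation; the
    other half pays for the step from \<open>u\<close> to \<open>v\<close>.\<close>
  have "\<exists>xs. sorted xs \<and> set xs \<subseteq> {u..w} \<and> variation f {u..w} \<le> path_sum f xs + ennreal (e/2)"
  proof (rule ccontr)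
    assume "\<not> ?thesis"
    then have less: "path_sum f xs + ennreal (e/2) \<le> variation f {u..w}"
      if "sorted xs" "set xs \<subseteq> {u..w}" for xs
      using that by (metis linear)
    have ne: "{xs. sorted xs \<and> set xs \<subseteq> {u..w}} \<noteq> {}" by (auto intro!: exI[of _ "[]"])
    have "variation f {u..w} + ennreal (e/2) \<le> variation f {u..w}"
      unfolding variation_eq_path_sum[of f "{u..w}"] ennreal_SUP_add_left[OF ne, symmetric]
      by (rule SUP_least) (use less in \<open>auto simp: variation_eq_path_sum\<close>)
    then show False
      using fin e by (cases "variation f {u..w}") (auto simp flip: ennreal_plus)
  qed
  then obtain xs where xs: "sorted xs" "set xs \<subseteq> {u..w}"
    and near: "variation f {u..w} \<le> path_sum f xs + ennreal (e/2)" by blast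
  \<comment> \<open>The entries not exceeding \<open>u\<close> are all equal to \<open>u\<close> and
    contribute nothing. Replacing them by one \<open>u\<close> leaves finitely many points strictly
    above \<open>u\<close>, hence room for \<open>v\<close>.\<close>
  define ps ys where "ps = takeWhile (\<lambda>x. x \<le> u) xs" and "ys = dropWhile (\<lambda>x. x \<le> u) xs"
  have eq: "xs = ps @ ys" unfolding ps_def ys_def by simp
  have psu: "p = u" if "p \<in> set ps" for p
    using that xs(2) eq unfolding ps_def by (fastforce dest: set_takeWhileD)
  have "path_sum f (ps @ [u]) = 0"
    using path_sum_cong[of "ps @ [u]" f "\<lambda>_. f u"] path_sum_le_variation[of "ps @ [u]" "{u}" f] psu
    by (fastforce simp: sorted_append xs(1)[unfolded eq sorted_append])
  then have xs_le: "path_sum f xs \<le> path_sum f (u # ys)"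
    using path_sum_insert_le[of f ps ys u] path_sum_append[of f ps u ys] eq by simp
  have ysu: "\<forall>y\<in>set ys. u < y"
  proof (cases ys)
    case (Cons z us)
    have "\<not> z \<le> u" using Cons unfolding ys_def by (simp add: dropWhile_eq_Cons_conv)
    moreover have "\<forall>x\<in>set ys. z \<le> x" using xs(1) eq Cons by (auto simp: sorted_append)
    ultimately show ?thesis by force
  qed auto
  have "(f \<longlongrightarrow> f u) (at_right u)"
    using cont by (simp add: continuous_within)
  then have "\<forall>\<^sub>F v in at_right u. dist (f v) (f u) < e/2"
    using e by (intro tendstoD) auto
  moreover have "\<forall>\<^sub>F v in at_right u. \<forall>y\<in>set ys. v < y"
    using ysu by (intro eventually_ball_finite ballI) (auto intro: order_tendstoD)
  moreover have "\<forall>\<^sub>F v in at_right u. v < w \<and> u < v"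
    using uw by (intro eventually_conj) (auto intro: order_tendstoD simp: eventually_at_right_less)
  ultimately have "\<forall>\<^sub>F v in at_right u. dist (f v) (f u) < e/2 \<and> (\<forall>y\<in>set ys. v < y) \<and> v < w \<and> u < v"
    by eventually_elim auto
  from eventually_happens'[OF trivial_limit_at_right_real this]
  obtain v where v: "dist (f v) (f u) < e/2" "\<forall>y\<in>set ys. v < y" "v < w" "u < v"
    by blast
  have "path_sum f (u # ys) \<le> ennreal \<bar>f v - f u\<bar> + path_sum f (v # ys)"
    by (rule path_sum_replace_hd)
  also have "\<dots> \<le> ennreal (e/2) + variation f {v..w}"
  proof (intro add_mono path_sum_le_variation ennreal_leI)
    show "\<bar>f v - f u\<bar> \<le> e/2" using v(1) by (simp add: dist_real_def)
    show "sorted (v # ys)" using v(2) xs(1) eq by (auto simp: sorted_append intro: less_imp_le)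
    show "set (v # ys) \<subseteq> {v..w}" using v xs(2) eq by (auto simp: subset_iff intro: less_imp_le)
  qed
  finally have "path_sum f xs \<le> ennreal (e/2) + variation f {v..w}"
    using xs_le by (rule order_trans[rotated])
  then have le: "variation f {u..w} \<le> (ennreal (e/2) + variation f {v..w}) + ennreal (e/2)"
    using near by (meson add_right_mono order_trans)
  \<comment> \<open>After this split the finite term \<open>variation f {v..w}\<close> cancels and
    the two halves of \<open>e\<close> remain.\<close>
  have "variation f {u..w} = variation f {u..v} + variation f {v..w}"
    using v by (intro variation_Icc_split) auto
  with le fin e have "variation f {u..v} \<le> ennreal e"
    by (cases "variation f {u..v}"; cases "variation f {v..w}")
       (auto simp flip: ennreal_plus)
  then show ?thesis using v by (intro exI[of _ v]) auto
qed

section \<open>Stieltjes measures of monotone functions\<close>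

text \<open>These are the hypotheses under which \<open>interval_measure F\<close> gives a half-open
  interval the increment of \<open>F\<close>.\<close>

definition right_cont_mono :: "(real \<Rightarrow> real) \<Rightarrow> bool" where
  "right_cont_mono F \<longleftrightarrow> (\<forall>x y. x \<le> y \<longrightarrow> F x \<le> F y) \<and> (\<forall>a. continuous (at_right a) F)"

lemma right_cont_mono_const: "right_cont_mono (\<lambda>_. c)"
  unfolding right_cont_mono_def by auto

lemma right_cont_monoD:
  assumes "right_cont_mono F"
  shows "x \<le> y \<Longrightarrow> F x \<le> F y" "continuous (at_right a) F"
  using assms unfolding right_cont_mono_def by auto

lemma emeasure_Ioc_right_cont_mono:
  "right_cont_mono F \<Longrightarrow> a \<le> b \<Longrightarrow> emeasure (interval_measure F) {a<..b} = ennreal (F b - F a)"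
  by (rule emeasure_interval_measure_Ioc) (auto dest: right_cont_monoD)

lemma measure_Ioc_right_cont_mono:
  "right_cont_mono F \<Longrightarrow> a \<le> b \<Longrightarrow> measure (interval_measure F) {a<..b} = F b - F a"
  by (rule measure_interval_measure_Ioc) (auto dest: right_cont_monoD)

text \<open>Subtraction in \<open>ennreal\<close> is truncated, so the usual rearrangement relies on
  the bounds and on finiteness. It serves the complement step of the next proof.\<close>

lemma ennreal_add_diff_add:
  fixes x y :: ennreal
  assumes "x' \<le> x" "y' \<le> y" "x < \<infinity>" "y < \<infinity>"
  shows "x + y - (x' + y') = (x - x') + (y - y')"
  using assms
  by (cases x; cases y; cases x'; cases y')
     (auto simp: ennreal_minus top_unique simp flip: ennreal_plus)

text \<open>Both sides are finite measures on \<open>{0<..s}\<close> that agree on half-open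
  intervals, so the pi-lambda argument applies. It has two uses: a constant \<open>G\<close> gives
  equality of two measures, a general \<open>G\<close> gives domination.\<close>

lemma emeasure_interval_measure_add:
  assumes F: "right_cont_mono F" and G: "right_cont_mono G" and K: "right_cont_mono K"
    and incr: "\<And>u v. 0 \<le> u \<Longrightarrow> u \<le> v \<Longrightarrow> v \<le> s \<Longrightarrow> K v - K u = (F v - F u) + (G v - G u)"
    and A: "A \<in> sets borel"
  shows "emeasure (interval_measure K) (A \<inter> {0<..s}) =
         emeasure (interval_measure F) (A \<inter> {0<..s}) + emeasure (interval_measure G) (A \<inter> {0<..s})"
proof -
  note E = emeasure_Ioc_right_cont_mono[OF F] emeasure_Ioc_right_cont_mono[OF G]
    emeasure_Ioc_right_cont_mono[OF K]
  have Ioc: "emeasure (interval_measure K) {u<..v} =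
      emeasure (interval_measure F) {u<..v} + emeasure (interval_measure G) {u<..v}"
    if "0 \<le> u" "v \<le> s" for u v
  proof (cases "u \<le> v")
    case True
    then show ?thesis
      using right_cont_monoD(1)[OF F True] right_cont_monoD(1)[OF G True] incr[of u v] that E
      by (simp flip: ennreal_plus)
  qed simp
  define \<A> where "\<A> = range (\<lambda>(a, b). {a<..b::real})"
  have "Int_stable \<A>"
    unfolding \<A>_def Int_stable_def by auto
  moreover have "\<A> \<subseteq> Pow UNIV" by simp
  moreover have "A \<in> sigma_sets UNIV \<A>"
    using A unfolding \<A>_def borel_sigma_sets_Ioc by simp
  ultimately show ?thesis
  proof (induction rule: sigma_sets_induct_disjoint)
    case (basic A)
    then obtain a b where "A = {a<..b}" unfolding \<A>_def by auto
    \<comment> \<open>Clamping brings the endpoints within reach of \<open>incr\<close>, which says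
      nothing outside \<open>[0, s]\<close>; an interval that becomes empty is covered as
      well.\<close>
    then have "A \<inter> {0<..s} = {max 0 a<..min b s}" by auto
    then show ?case using Ioc[of "max 0 a" "min b s"] by simp
  next
    case empty
    then show ?case by simp
  next
    case (compl A)
    have A': "A \<in> sets borel"
      using compl unfolding \<A>_def borel_sigma_sets_Ioc by simp
    have le: "emeasure (interval_measure L) (A \<inter> {0<..s}) \<le> emeasure (interval_measure L) {0<..s}" for L
      by (intro emeasure_mono) auto
    \<comment> \<open>The whole line may have infinite measure, so the complement is taken inside
      \<open>{0<..s}\<close>, whose mass is finite.\<close>
    have tot_fin: "emeasure (interval_measure L) {0<..s} < \<infinity>"
      if "right_cont_mono L" for L
      using emeasure_Ioc_right_cont_mono[OF that, of 0 s] by (cases "0 \<le> s") auto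
    have fin: "emeasure (interval_measure L) (A \<inter> {0<..s}) \<noteq> \<infinity>"
      if "right_cont_mono L" for L
      using le_less_trans[OF le tot_fin[OF that]] by simp
    have diff: "emeasure (interval_measure L) ((UNIV - A) \<inter> {0<..s}) =
        emeasure (interval_measure L) {0<..s} - emeasure (interval_measure L) (A \<inter> {0<..s})"
      if "right_cont_mono L" for L
    proof -
      have "(UNIV - A) \<inter> {0<..s} = {0<..s} - (A \<inter> {0<..s})" by auto
      then show ?thesis using A' fin[OF that] by (simp add: emeasure_Diff)
    qed
    have tot: "emeasure (interval_measure K) {0<..s} =
      emeasure (interval_measure F) {0<..s} + emeasure (interval_measure G) {0<..s}"
      by (rule Ioc) auto
    show ?case
      unfolding diff[OF F] diff[OF G] diff[OF K] compl(2) tot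
      by (intro ennreal_add_diff_add le tot_fin F G)
  next
    case (union A)
    have A': "A i \<in> sets borel" for i
      using union unfolding \<A>_def borel_sigma_sets_Ioc by auto
    have dj: "disjoint_family (\<lambda>i. A i \<inter> {0<..s})"
      using union(1) unfolding disjoint_family_on_def by blast
    have eq: "emeasure (interval_measure L) (\<Union>(range A) \<inter> {0<..s}) =
        (\<Sum>i. emeasure (interval_measure L) (A i \<inter> {0<..s}))" for L
      using suminf_emeasure[of "\<lambda>i. A i \<inter> {0<..s}" "interval_measure L"] dj A'
      by (auto simp: image_subset_iff)
    show ?case
      unfolding eq union(3) by (rule suminf_add[symmetric]) auto
  qed
qed

lemma restrict_interval_measure_cong:
  assumes F: "right_cont_mono F" and G: "right_cont_mono G"
    and incr: "\<And>u v. 0 \<le> u \<Longrightarrow> u \<le> v \<Longrightarrow> v \<le> s \<Longrightarrow> F v - F u = G v - G u"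
  shows "restrict_space (interval_measure F) {0<..s} = restrict_space (interval_measure G) {0<..s}"
proof (rule measure_eqI)
  show "sets (restrict_space (interval_measure F) {0<..s}) = sets (restrict_space (interval_measure G) {0<..s})"
    by (simp add: sets_restrict_space)
  fix A assume "A \<in> sets (restrict_space (interval_measure F) {0<..s})"
  then have A: "A \<in> sets borel" "A \<subseteq> {0<..s}"
    by (auto simp: sets_restrict_space_iff)
  \<comment> \<open>A constant function serves as the second summand: its measure puts no mass on
    \<open>{0<..s}\<close>, and additivity becomes equality.\<close>
  define Z where "Z = interval_measure (\<lambda>_. 0)"
  have "emeasure Z (A \<inter> {0<..s}) \<le> emeasure Z {0<..s}"
    unfolding Z_def by (intro emeasure_mono) auto
  also have "\<dots> = 0"
    unfolding Z_def using emeasure_Ioc_right_cont_mono[OF right_cont_mono_const, of 0 s 0] by (cases "0 \<le> s") auto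
  finally have "emeasure (interval_measure F) (A \<inter> {0<..s}) = emeasure (interval_measure G) (A \<inter> {0<..s})"
    using emeasure_interval_measure_add[OF G right_cont_mono_const F, of s 0 A] incr A(1)
    by (simp add: Z_def)
  moreover have "A \<inter> {0<..s} = A" using A(2) by auto
  ultimately show "emeasure (restrict_space (interval_measure F) {0<..s}) A =
      emeasure (restrict_space (interval_measure G) {0<..s}) A"
    using A by (simp add: emeasure_restrict_space)
qed

lemma set_lebesgue_integral_interval_measure_cong:
  fixes h :: "real \<Rightarrow> real"
  assumes "right_cont_mono F" "right_cont_mono G"
    and "\<And>u v. 0 \<le> u \<Longrightarrow> u \<le> v \<Longrightarrow> v \<le> s \<Longrightarrow> F v - F u = G v - G u"
  shows "(LINT x:{0<..s}|interval_measure F. h x) = (LINT x:{0<..s}|interval_measure G. h x)"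
  using arg_cong[OF restrict_interval_measure_cong[OF assms], where f = "\<lambda>M. integral\<^sup>L M h"]
  by (simp add: integral_restrict_space set_lebesgue_integral_def)

text \<open>On \<open>{0<..s}\<close> the measure of \<open>K\<close> exceeds that of
  \<open>F\<close> by that of \<open>G\<close>. In the application \<open>K\<close> is the variation
  of a path, and \<open>F\<close> and \<open>G\<close> are its two monotone parts.\<close>

lemma set_nn_integral_interval_measure_mono:
  assumes F: "right_cont_mono F" and G: "right_cont_mono G" and K: "right_cont_mono K"
    and incr: "\<And>u v. 0 \<le> u \<Longrightarrow> u \<le> v \<Longrightarrow> v \<le> s \<Longrightarrow> K v - K u = (F v - F u) + (G v - G u)"
  shows "(\<integral>\<^sup>+x\<in>{0<..s}. h x \<partial>interval_measure F) \<le> (\<integral>\<^sup>+x\<in>{0<..s}. h x \<partial>interval_measure K)"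
proof -
  have "restrict_space (interval_measure F) {0<..s} \<le> restrict_space (interval_measure K) {0<..s}"
  proof (subst le_measure)
    show "sets (restrict_space (interval_measure F) {0<..s}) = sets (restrict_space (interval_measure K) {0<..s})"
      by (simp add: sets_restrict_space)
    show "\<forall>A\<in>sets (restrict_space (interval_measure F) {0<..s}).
      emeasure (restrict_space (interval_measure F) {0<..s}) A \<le> emeasure (restrict_space (interval_measure K) {0<..s}) A"
    proof
      fix A assume "A \<in> sets (restrict_space (interval_measure F) {0<..s})"
      then have A: "A \<in> sets borel" "A \<subseteq> {0<..s}" "A \<inter> {0<..s} = A"
        by (auto simp: sets_restrict_space_iff)
      then show "emeasure (restrict_space (interval_measure F) {0<..s}) A \<le> emeasure (restrict_space (interval_measure K) {0<..s}) A"
        using emeasure_interval_measure_add[OF F G K incr A(1), of s]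
        by (simp add: emeasure_restrict_space)
    qed
  qed
  then have "nn_integral (restrict_space (interval_measure F) {0<..s}) h \<le> nn_integral (restrict_space (interval_measure K) {0<..s}) h"
    by (intro nn_integral_mono_measure) (simp_all add: sets_restrict_space)
  then show ?thesis by (simp add: nn_integral_restrict_space)
qed

lemma emeasure_interval_measure_singleton_finite:
  assumes "right_cont_mono F"
  shows "emeasure (interval_measure F) {t} < \<infinity>"
proof -
  have "emeasure (interval_measure F) {t} \<le> emeasure (interval_measure F) {t - 1<..t}"
    by (intro emeasure_mono) auto
  also have "\<dots> < \<infinity>" using assms by (simp add: emeasure_Ioc_right_cont_mono)
  finally show ?thesis .
qed

lemma tendsto_set_integral_Ioc_at_left:
  fixes h :: "real \<Rightarrow> real"
  assumes F: "right_cont_mono F" and t: "0 < t" and int: "set_integrable (interval_measure F) {0<..t} h"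
  shows "((\<lambda>s. LINT x:{0<..s}|interval_measure F. h x) \<longlongrightarrow>
     (LINT x:{0<..t}|interval_measure F. h x) - h t * measure (interval_measure F) {t}) (at_left t)"
proof -
  let ?M = "interval_measure F"
  \<comment> \<open>The limit theorem used below is about intervals closed at \<open>0\<close>.
    Setting the integrand to zero there turns integrals over \<open>{0..s}\<close> into integrals
    over \<open>{0<..s}\<close>, whatever mass the measure has at \<open>0\<close>.\<close>
  define f where "f x = indicator {0<..} x *\<^sub>R h x" for x :: real
  have eq: "(LINT x:{0..s}|?M. f x) = (LINT x:{0<..s}|?M. h x)" for s
    unfolding set_lebesgue_integral_def f_def by (intro Bochner_Integration.integral_cong) (auto simp: indicator_def)
  have eq': "(LINT x:{0..<t}|?M. f x) = (LINT x:{0<..<t}|?M. h x)"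
    unfolding set_lebesgue_integral_def f_def by (intro Bochner_Integration.integral_cong) (auto simp: indicator_def)
  have i1: "set_integrable ?M {0<..<t} h" "set_integrable ?M {t} h"
    using t by (auto intro: set_integrable_subset[OF int])
  have "set_integrable ?M {0..<t} f"
  proof -
    have "(\<lambda>x. indicator {0..<t} x *\<^sub>R f x) = (\<lambda>x. indicator {0<..<t} x *\<^sub>R h x)"
      using t by (auto simp: f_def indicator_def fun_eq_iff)
    then show ?thesis using i1(1) unfolding set_integrable_def by simp
  qed
  then have "((\<lambda>s. LINT x:{0..s}|?M. f x) \<longlongrightarrow> (LINT x:{0..<t}|?M. f x)) (at_left t)"
    by (intro tendsto_set_lebesgue_integral_at_left[OF t]) auto
  moreover have "(LINT x:{0<..t}|?M. h x) = (LINT x:{0<..<t}|?M. h x) + (LINT x:{t}|?M. h x)"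
  proof -
    have "{0<..t} = {0<..<t} \<union> {t}" using t by auto
    then show ?thesis using set_integral_Un[OF _ i1] by simp
  qed
  moreover have "(LINT x:{t}|?M. h x) = h t * measure ?M {t}"
    using emeasure_interval_measure_singleton_finite[OF F, of t] i1(2)
    by (intro set_integral_at_point) auto
  ultimately show ?thesis
    unfolding eq eq' by simp
qed

text \<open>This is the preceding lemma for the integrand \<open>1\<close>, whose integral over
  \<open>{0<..s}\<close> is \<open>F s - F 0\<close>. It identifies jumps of \<open>F\<close> with
  atoms.\<close>

lemma right_cont_mono_tendsto_at_left:
  assumes F: "right_cont_mono F" and t: "0 < t"
  shows "(F \<longlongrightarrow> F t - measure (interval_measure F) {t}) (at_left t)"
proof -
  let ?M = "interval_measure F"
  have int: "(LINT x:{0<..s}|?M. (1::real)) = F s - F 0" if "0 \<le> s" for s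
    using measure_Ioc_right_cont_mono[OF F that] emeasure_Ioc_right_cont_mono[OF F that]
    by (simp add: set_lebesgue_integral_def)
  have "set_integrable ?M {0<..t} (\<lambda>_. 1::real)"
    using emeasure_Ioc_right_cont_mono[OF F, of 0 t] t
    unfolding set_integrable_def by (simp add: integrable_indicator_iff)
  from tendsto_set_integral_Ioc_at_left[OF F t this]
  have "((\<lambda>s. LINT x:{0<..s}|?M. (1::real)) \<longlongrightarrow> F t - F 0 - measure ?M {t}) (at_left t)"
    using int[of t] t by simp
  moreover have "\<forall>\<^sub>F s in at_left t. (LINT x:{0<..s}|?M. (1::real)) = F s - F 0"
    using eventually_at_left_real[OF t] by eventually_elim (auto intro: int)
  ultimately have "((\<lambda>s. F s - F 0) \<longlongrightarrow> F t - F 0 - measure ?M {t}) (at_left t)"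
    by (subst (asm) tendsto_cong) auto
  from tendsto_add[OF this tendsto_const[of "F 0"]] show ?thesis by simp
qed

text \<open>These features of a path continued constantly outside \<open>[0, t]\<close> make its
  variation and its two monotone parts Stieltjes functions on the whole line. Variation is counted
  from \<open>0\<close>, hence vanishes on the left of \<open>0\<close>, and
  \<open>const_neg\<close> keeps the path in step with it there.\<close>

locale rc_bv_path =
  fixes g :: "real \<Rightarrow> real"
  assumes right_cont: "continuous (at_right u) g"
    and const_neg: "u \<le> 0 \<Longrightarrow> g u = g 0"
    and var_finite: "variation g {0..u} < top"
begin

abbreviation "V u \<equiv> enn2real (variation g {0..u})"

lemma V_neg: "u \<le> 0 \<Longrightarrow> V u = 0"
  by (cases "u = 0") auto

lemma V_increment:
  assumes "0 \<le> u" "u \<le> v"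
  shows "variation g {u..v} = ennreal (V v - V u)"
  using variation_Icc_split[OF assms, of g] var_finite[of u] var_finite[of v]
  by (cases "variation g {0..u}"; cases "variation g {u..v}") (auto simp flip: ennreal_plus)

lemma V_mono: "u \<le> v \<Longrightarrow> V u \<le> V v"
  using variation_mono[of "{0..u}" "{0..v}" g] var_finite[of v] by (intro enn2real_mono) auto

text \<open>This estimate is what makes both \<open>V + g\<close> and \<open>V - g\<close>
  nondecreasing.\<close>

lemma abs_diff_le_V_diff:
  assumes "u \<le> v"
  shows "\<bar>g v - g u\<bar> \<le> V v - V u"
proof -
  have *: "\<bar>g y - g x\<bar> \<le> V y - V x" if "0 \<le> x" "x \<le> y" for x y
    using abs_diff_le_variation[OF that(2), of g] V_increment[OF that] V_mono[OF that(2)]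
    by (simp add: ennreal_le_iff)
  show ?thesis
  proof (cases "0 \<le> u")
    case False
    \<comment> \<open>Negative arguments can be replaced by \<open>0\<close>, because
      \<open>g\<close> and \<open>V\<close> are constant on the left of \<open>0\<close>.\<close>
    then show ?thesis
      using *[of 0 "max 0 v"] const_neg[of u] const_neg[of v] V_neg[of u] V_neg[of v]
      by (cases "0 \<le> v") auto
  qed (use * assms in auto)
qed

text \<open>An increment of \<open>V\<close> is the variation over the interval in between, which
  \<open>variation_small_right\<close> makes small where \<open>g\<close> is
  right-continuous.\<close>

lemma V_right_cont: "continuous (at_right u) V"
proof (cases "0 \<le> u")
  case True
  have "(V \<longlongrightarrow> V u) (at_right u)"
  proof (rule tendstoI)
    fix e :: real assume e: "0 < e"
    have "variation g {u..u + 1} < top"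
      using V_increment[of u "u + 1"] True by simp
    \<comment> \<open>Asking for \<open>e/2\<close> turns the weak bound into the strict one
      demanded by \<open>tendstoI\<close>.\<close>
    from variation_small_right[OF right_cont _ this, of "e/2"] e
    obtain v where v: "v > u" "variation g {u..v} \<le> ennreal (e/2)" by auto
    have "\<forall>\<^sub>F x in at_right u. u < x \<and> x < v"
      using v(1) by (auto intro!: eventually_conj intro: order_tendstoD simp: eventually_at_right_less)
    then show "\<forall>\<^sub>F x in at_right u. dist (V x) (V u) < e"
    proof eventually_elim
      case (elim x)
      have "variation g {u..v} = ennreal (V v - V u)"
        using V_increment[of u v] v True by simp
      then have "V v - V u \<le> e/2"
        using v e by (simp add: ennreal_le_iff)
      then show ?case
        using V_mono[of u x] V_mono[of x v] elim e by (simp add: dist_real_def)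
    qed
  qed
  then show ?thesis by (simp add: continuous_within)
next
  case False
  have "\<forall>\<^sub>F x in at_right u. x < 0"
    using False by (auto intro: order_tendstoD)
  then have "\<forall>\<^sub>F x in at_right u. 0 = V x"
    by eventually_elim (use V_neg in force)
  then have "(V \<longlongrightarrow> 0) (at_right u)"
    by (rule Lim_transform_eventually[OF tendsto_const])
  then show ?thesis using V_neg[of u] False by (simp add: continuous_within)
qed

lemma right_cont_mono_parts:
  shows "right_cont_mono V" "right_cont_mono (\<lambda>u. (V u + g u) / 2)" "right_cont_mono (\<lambda>u. (V u - g u) / 2)"
proof -
  show "right_cont_mono V"
    unfolding right_cont_mono_def using V_mono V_right_cont by auto
  show "right_cont_mono (\<lambda>u. (V u + g u) / 2)" "right_cont_mono (\<lambda>u. (V u - g u) / 2)"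
    unfolding right_cont_mono_def using abs_diff_le_V_diff
    by (auto intro!: continuous_intros V_right_cont right_cont) (smt (verit))+
qed

end

section \<open>Pathwise Lebesgue--Stieltjes integrals\<close>

lemma ext_path_restrict: "0 \<le> s \<Longrightarrow> s \<le> t \<Longrightarrow> u \<le> s \<Longrightarrow> ext_path s a u = ext_path t a u"
  unfolding ext_path_def by (simp add: min_def)

lemma var_path_restrict: "0 \<le> s \<Longrightarrow> s \<le> t \<Longrightarrow> u \<le> s \<Longrightarrow> var_path s a u = var_path t a u"
  unfolding var_path_def by (intro arg_cong[where f = enn2real] variation_cong ext_path_restrict) auto

lemma ext_path_cong: "(\<And>x. x \<in> {0..t} \<Longrightarrow> a x = b x) \<Longrightarrow> 0 \<le> t \<Longrightarrow> ext_path t a = ext_path t b"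
  unfolding ext_path_def by (rule ext) auto

text \<open>For the continued path, stopping at \<open>r\<close> and taking the horizon
  \<open>r\<close> are the same operation. Integrals against stopped paths thus use the measures of
  horizon \<open>r\<close>.\<close>

lemma ext_path_stop: "0 \<le> r \<Longrightarrow> r \<le> t \<Longrightarrow> ext_path t (\<lambda>s. a (min s r)) = ext_path r a"
  unfolding ext_path_def by (auto simp: fun_eq_iff min_def max_def intro!: arg_cong[where f = a])

lemma rc_bv_path_ext_path:
  assumes y: "cadlag y" and fin: "variation y {0..t} < top" and t: "0 \<le> t"
  shows "rc_bv_path (ext_path t y)"
proof
  fix u
  show "u \<le> 0 \<Longrightarrow> ext_path t y u = ext_path t y 0"
    using t by (simp add: ext_path_def min_def max_def)
  have fin_t: "variation (ext_path t y) {0..t} < top"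
    using fin variation_cong[of "{0..t}" "ext_path t y" y] by (simp add: ext_path_def)
  show "variation (ext_path t y) {0..u} < top"
  proof (cases "u \<le> t")
    case True
    then show ?thesis
      using variation_mono[of "{0..u}" "{0..t}" "ext_path t y"] fin_t by (auto intro: le_less_trans)
  next
    case False
    have "variation (ext_path t y) {t..u} = variation (\<lambda>_. y t) {t..u}"
      using t by (intro variation_cong) (simp add: ext_path_def)
    then show ?thesis
      using variation_Icc_split[of 0 t u "ext_path t y"] fin_t False t by simp
  qed
  \<comment> \<open>The point \<open>t\<close> belongs to the last case: on its right the path is
    frozen, whatever \<open>y\<close> does there.\<close>
  consider "u < 0" | "0 \<le> u" "u < t" | "t \<le> u" by linarith
  then show "continuous (at_right u) (ext_path t y)"
  proof cases
    case 1
    have "\<forall>\<^sub>F x in at_right u. x < 0" using 1 by (auto intro: order_tendstoD)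
    then have "\<forall>\<^sub>F x in at_right u. ext_path t y u = ext_path t y x"
      by eventually_elim (use 1 t in \<open>simp add: ext_path_def min_def max_def\<close>)
    then show ?thesis
      unfolding continuous_within by (rule Lim_transform_eventually[OF tendsto_const])
  next
    case 2
    have "\<forall>\<^sub>F x in at_right u. u < x \<and> x < t"
      using 2 by (auto intro!: eventually_conj intro: order_tendstoD simp: eventually_at_right_less)
    then have "\<forall>\<^sub>F x in at_right u. y x = ext_path t y x"
      by eventually_elim (use 2 in \<open>simp add: ext_path_def\<close>)
    moreover have "(y \<longlongrightarrow> y u) (at_right u)" using y 2 by (simp add: cadlag_def)
    ultimately have "(ext_path t y \<longlongrightarrow> y u) (at_right u)"
      by (rule Lim_transform_eventually[rotated])
    then show ?thesis using 2 by (simp add: continuous_within ext_path_def)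
  next
    case 3
    have "\<forall>\<^sub>F x in at_right u. u < x" by (simp add: eventually_at_right_less)
    then have "\<forall>\<^sub>F x in at_right u. ext_path t y u = ext_path t y x"
      by eventually_elim (use 3 t in \<open>simp add: ext_path_def\<close>)
    then show ?thesis
      unfolding continuous_within by (rule Lim_transform_eventually[OF tendsto_const])
  qed
qed

text \<open>Together with \<open>neg_part_path\<close> this is a Jordan decomposition: the sum is
  the variation, the difference the path. The parts start at plus and minus half of
  \<open>a 0\<close>; only their increments matter, the mass at \<open>0\<close> being added
  separately.\<close>

abbreviation pos_part_path :: "real \<Rightarrow> (real \<Rightarrow> real) \<Rightarrow> real \<Rightarrow> real" where
  "pos_part_path t a \<equiv> (\<lambda>u. (var_path t a u + ext_path t a u) / 2)"

abbreviation neg_part_path :: "real \<Rightarrow> (real \<Rightarrow> real) \<Rightarrow> real \<Rightarrow> real" where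
  "neg_part_path t a \<equiv> (\<lambda>u. (var_path t a u - ext_path t a u) / 2)"

lemma right_cont_mono_path_parts:
  assumes "rc_bv_path (ext_path t a)"
  shows "right_cont_mono (var_path t a)" "right_cont_mono (pos_part_path t a)" "right_cont_mono (neg_part_path t a)"
  using rc_bv_path.right_cont_mono_parts[OF assms] by (simp_all add: var_path_def[abs_def])

lemma LS_integral_cong:
  assumes "0 \<le> t" and h: "\<And>x. x \<in> {0..t} \<Longrightarrow> h x = h' x" and a: "\<And>x. x \<in> {0..t} \<Longrightarrow> a x = a' x"
  shows "LS_integral t h a = LS_integral t h' a'"
proof -
  have "ext_path t a = ext_path t a'" by (rule ext_path_cong) (use a assms(1) in auto)
  moreover from this have "var_path t a = var_path t a'" by (simp add: var_path_def[abs_def])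
  moreover have "(LINT s:{0<..t}|N. h s) = (LINT s:{0<..t}|N. h' s)" for N
    unfolding set_lebesgue_integral_def using h
    by (intro Bochner_Integration.integral_cong) (auto simp: indicator_def)
  ultimately show ?thesis using assms unfolding LS_integral_def by simp
qed

lemma LS_abs_integral_cong:
  assumes "0 \<le> t" and h: "\<And>x. x \<in> {0..t} \<Longrightarrow> h x = h' x" and a: "\<And>x. x \<in> {0..t} \<Longrightarrow> a x = a' x"
  shows "LS_abs_integral t h a = LS_abs_integral t h' a'"
proof -
  have "ext_path t a = ext_path t a'" by (rule ext_path_cong) (use a assms(1) in auto)
  then have "var_path t a = var_path t a'" by (simp add: var_path_def[abs_def])
  moreover have "(\<integral>\<^sup>+s\<in>{0<..t}. ennreal \<bar>h s\<bar> \<partial>N) = (\<integral>\<^sup>+s\<in>{0<..t}. ennreal \<bar>h' s\<bar> \<partial>N)" for N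
    using h by (intro nn_integral_cong) (auto simp: indicator_def)
  ultimately show ?thesis using assms unfolding LS_abs_integral_def by simp
qed

text \<open>Both horizons give the parts the same increments on \<open>[0, s]\<close>. All integrals
  up to times \<open>s \<le> t\<close> are thereby taken against one pair of measures, which opens
  the way to limits in \<open>s\<close>.\<close>

lemma LS_integral_restrict:
  assumes s: "rc_bv_path (ext_path s a)" and t: "rc_bv_path (ext_path t a)" and "0 \<le> s" "s \<le> t"
  shows "LS_integral s h a = h 0 * a 0 +
    ((LINT x:{0<..s}|interval_measure (pos_part_path t a). h x) -
     (LINT x:{0<..s}|interval_measure (neg_part_path t a). h x))"
proof -
  have "(LINT x:{0<..s}|interval_measure (pos_part_path s a). h x) =
      (LINT x:{0<..s}|interval_measure (pos_part_path t a). h x)"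
    using assms(3,4)
    by (intro set_lebesgue_integral_interval_measure_cong right_cont_mono_path_parts s t)
       (simp_all add: ext_path_restrict[of s t] var_path_restrict[of s t])
  moreover have "(LINT x:{0<..s}|interval_measure (neg_part_path s a). h x) =
      (LINT x:{0<..s}|interval_measure (neg_part_path t a). h x)"
    using assms(3,4)
    by (intro set_lebesgue_integral_interval_measure_cong right_cont_mono_path_parts s t)
       (simp_all add: ext_path_restrict[of s t] var_path_restrict[of s t])
  ultimately show ?thesis unfolding LS_integral_def by simp
qed

lemma set_borel_measurable_interval_measure:
  "set_borel_measurable (interval_measure F) A h = set_borel_measurable borel A h"
  unfolding set_borel_measurable_def by (simp cong: measurable_cong_sets)

text \<open>Each part is dominated by the variation, the other part being the difference, so the
  finite absolute integral bounds both integrals.\<close>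

lemma set_integrable_path_parts:
  assumes a: "rc_bv_path (ext_path t a)" and h: "set_borel_measurable borel {0<..t} h"
    and fin: "LS_abs_integral t h a < top"
  shows "set_integrable (interval_measure (pos_part_path t a)) {0<..t} h"
    "set_integrable (interval_measure (neg_part_path t a)) {0<..t} h"
proof -
  note parts = right_cont_mono_path_parts[OF a]
  have var: "(\<integral>\<^sup>+x\<in>{0<..t}. ennreal \<bar>h x\<bar> \<partial>interval_measure (var_path t a)) < \<infinity>"
    using fin unfolding LS_abs_integral_def by (auto simp: top_unique less_top)
  have *: "set_integrable (interval_measure F) {0<..t} h"
    if F: "(\<integral>\<^sup>+x\<in>{0<..t}. ennreal \<bar>h x\<bar> \<partial>interval_measure F) < \<infinity>" for F
    unfolding set_integrable_def
  proof (rule integrableI_bounded)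
    show "(\<lambda>x. indicat_real {0<..t} x *\<^sub>R h x) \<in> borel_measurable (interval_measure F)"
      using h unfolding set_borel_measurable_def by simp
    have "(\<integral>\<^sup>+x. ennreal (norm (indicat_real {0<..t} x *\<^sub>R h x)) \<partial>interval_measure F) =
       (\<integral>\<^sup>+x\<in>{0<..t}. ennreal \<bar>h x\<bar> \<partial>interval_measure F)"
      by (intro nn_integral_cong) (auto simp: indicator_def)
    then show "(\<integral>\<^sup>+x. ennreal (norm (indicat_real {0<..t} x *\<^sub>R h x)) \<partial>interval_measure F) < \<infinity>"
      using F by simp
  qed
  show "set_integrable (interval_measure (pos_part_path t a)) {0<..t} h"
    by (rule *, rule le_less_trans[OF set_nn_integral_interval_measure_mono var])
       (rule parts parts(3) | simp add: field_simps)+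
  show "set_integrable (interval_measure (neg_part_path t a)) {0<..t} h"
    by (rule *, rule le_less_trans[OF set_nn_integral_interval_measure_mono var])
       (rule parts parts(2) | simp add: field_simps)+
qed

lemma LS_integral_tendsto_at_left:
  assumes path: "\<And>s. 0 \<le> s \<Longrightarrow> s \<le> t \<Longrightarrow> rc_bv_path (ext_path s a)" and t: "0 < t"
    and h: "set_borel_measurable borel {0<..t} h" and fin: "LS_abs_integral t h a < top"
    and l: "(a \<longlongrightarrow> l) (at_left t)"
  shows "((\<lambda>s. LS_integral s h a) \<longlongrightarrow> LS_integral t h a - h t * (a t - l)) (at_left t)"
proof -
  let ?P = "interval_measure (pos_part_path t a)" and ?N = "interval_measure (neg_part_path t a)"
  have a: "rc_bv_path (ext_path t a)" using path t by simp
  note parts = right_cont_mono_path_parts[OF a]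
  note int = set_integrable_path_parts[OF a h fin]
  have ev: "\<forall>\<^sub>F s in at_left t. s \<in> {0<..<t}" by (rule eventually_at_left_real[OF t])
  \<comment> \<open>Uniqueness of left limits expresses the jump of \<open>a\<close> at
    \<open>t\<close> by the atoms of the same two measures, which makes it comparable with the jump
    of the integral.\<close>
  have "((\<lambda>s. pos_part_path t a s - neg_part_path t a s) \<longlongrightarrow>
      (pos_part_path t a t - measure ?P {t}) - (neg_part_path t a t - measure ?N {t})) (at_left t)"
    by (intro tendsto_diff right_cont_mono_tendsto_at_left parts t)
  moreover have "\<forall>\<^sub>F s in at_left t. pos_part_path t a s - neg_part_path t a s = a s"
    using ev by eventually_elim (auto simp: ext_path_def field_simps)
  ultimately have "(a \<longlongrightarrow> (pos_part_path t a t - measure ?P {t}) - (neg_part_path t a t - measure ?N {t})) (at_left t)"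
    by (rule Lim_transform_eventually)
  from tendsto_unique[OF trivial_limit_at_left_real l this]
  have l_eq: "l = a t - (measure ?P {t} - measure ?N {t})"
    using t by (simp add: ext_path_def field_simps)
  have "((\<lambda>s. h 0 * a 0 + ((LINT x:{0<..s}|?P. h x) - (LINT x:{0<..s}|?N. h x))) \<longlongrightarrow>
     h 0 * a 0 + (((LINT x:{0<..t}|?P. h x) - h t * measure ?P {t}) -
                  ((LINT x:{0<..t}|?N. h x) - h t * measure ?N {t}))) (at_left t)"
    by (intro tendsto_diff tendsto_add tendsto_const tendsto_set_integral_Ioc_at_left parts t int)
  \<comment> \<open>Each \<open>LS_integral s\<close> has its own measures; they are exchanged for
    those of horizon \<open>t\<close>.\<close>
  moreover have "\<forall>\<^sub>F s in at_left t.
      h 0 * a 0 + ((LINT x:{0<..s}|?P. h x) - (LINT x:{0<..s}|?N. h x)) = LS_integral s h a"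
    using ev by eventually_elim (auto intro!: LS_integral_restrict[symmetric] path)
  ultimately have "((\<lambda>s. LS_integral s h a) \<longlongrightarrow>
     h 0 * a 0 + (((LINT x:{0<..t}|?P. h x) - h t * measure ?P {t}) -
                  ((LINT x:{0<..t}|?N. h x) - h t * measure ?N {t}))) (at_left t)"
    by (rule Lim_transform_eventually)
  moreover have "h 0 * a 0 + (((LINT x:{0<..t}|?P. h x) - h t * measure ?P {t}) -
                  ((LINT x:{0<..t}|?N. h x) - h t * measure ?N {t})) = LS_integral t h a - h t * (a t - l)"
    unfolding LS_integral_def l_eq by (simp add: algebra_simps)
  ultimately show ?thesis by simp
qed

section \<open>Stopped integrators and cut integrands\<close>

lemma emeasure_Ioc_stopped_path:
  assumes a: "rc_bv_path (ext_path r a)" and r: "0 \<le> r" "r \<le> t"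
  shows "emeasure (interval_measure (var_path r a)) {r<..t} = 0"
    "emeasure (interval_measure (pos_part_path r a)) {r<..t} = 0"
    "emeasure (interval_measure (neg_part_path r a)) {r<..t} = 0"
proof -
  have e: "ext_path r a t = ext_path r a r" using r by (simp add: ext_path_def)
  have "variation (ext_path r a) {r..t} = variation (\<lambda>_. a r) {r..t}"
    using r by (intro variation_cong) (simp add: ext_path_def)
  then have v: "var_path r a t = var_path r a r"
    using variation_Icc_split[OF r, of "ext_path r a"] by (simp add: var_path_def)
  note parts = right_cont_mono_path_parts[OF a]
  show "emeasure (interval_measure (var_path r a)) {r<..t} = 0"
    "emeasure (interval_measure (pos_part_path r a)) {r<..t} = 0"
    "emeasure (interval_measure (neg_part_path r a)) {r<..t} = 0"
    using parts[THEN emeasure_Ioc_right_cont_mono, OF r(2)] e v by simp_all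
qed

lemma AE_stopped_path:
  fixes r t :: real
  assumes null: "emeasure (interval_measure F) {r<..t} = 0" and r: "0 \<le> r" "r \<le> t"
  shows "AE x in interval_measure F. x \<in> {0<..t} \<longleftrightarrow> x \<in> {0<..r}"
  by (rule AE_I[OF _ null]) (use r in auto)

lemma LS_integral_stop_integrator:
  assumes a: "rc_bv_path (ext_path r a)" and r: "0 \<le> r" "r \<le> t"
    and h: "set_borel_measurable borel {0<..t} h"
  shows "LS_integral t h (\<lambda>s. a (min s r)) = LS_integral r h a"
proof -
  have v: "var_path t (\<lambda>s. a (min s r)) = var_path r a"
    unfolding var_path_def[abs_def] ext_path_stop[OF r] ..
  have hr: "set_borel_measurable borel {0<..r} h"
    by (rule set_borel_measurable_subset[OF h]) (use r in auto)
  have *: "(LINT x:{0<..t}|interval_measure F. h x) = (LINT x:{0<..r}|interval_measure F. h x)"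
    if "emeasure (interval_measure F) {r<..t} = 0" for F
    using AE_stopped_path[OF that r] h hr
    by (intro set_integral_cong_set) (auto simp: set_borel_measurable_interval_measure)
  \<comment> \<open>After unfolding, the measures are already those of horizon \<open>r\<close>;
    only the domain of integration is still \<open>{0<..t}\<close>.\<close>
  show ?thesis
    unfolding LS_integral_def v ext_path_stop[OF r]
    using r *[OF emeasure_Ioc_stopped_path(2)[OF a r]] *[OF emeasure_Ioc_stopped_path(3)[OF a r]]
    by (simp add: min_def)
qed

lemma LS_abs_integral_stop_integrator:
  assumes a: "rc_bv_path (ext_path r a)" and r: "0 \<le> r" "r \<le> t"
  shows "LS_abs_integral t h (\<lambda>s. a (min s r)) = LS_abs_integral r h a"
proof -
  have v: "var_path t (\<lambda>s. a (min s r)) = var_path r a"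
    unfolding var_path_def[abs_def] ext_path_stop[OF r] ..
  have "(\<integral>\<^sup>+x\<in>{0<..t}. ennreal \<bar>h x\<bar> \<partial>interval_measure (var_path r a)) =
      (\<integral>\<^sup>+x\<in>{0<..r}. ennreal \<bar>h x\<bar> \<partial>interval_measure (var_path r a))"
    using AE_stopped_path[OF emeasure_Ioc_stopped_path(1)[OF a r] r]
    by (intro nn_integral_cong_AE, elim eventually_mono) (simp add: indicator_def)
  then show ?thesis
    unfolding LS_abs_integral_def v using r by (simp add: min_def)
qed

lemma LS_integral_cut_integrand:
  assumes "rc_bv_path (ext_path r a)" "rc_bv_path (ext_path t a)" and r: "0 \<le> r" "r \<le> t"
  shows "LS_integral t (\<lambda>s. if s \<le> r then h s else 0) a = LS_integral r h a"
proof -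
  have "(LINT x:{0<..t}|M. if x \<le> r then h x else 0) = (LINT x:{0<..r}|M. h x)" for M
    unfolding set_lebesgue_integral_def using r
    by (intro Bochner_Integration.integral_cong) (auto simp: indicator_def)
  \<comment> \<open>Cutting shortens the domain but keeps the measures of horizon \<open>t\<close>;
    the right-hand side is therefore rewritten to that horizon.\<close>
  then show ?thesis
    unfolding LS_integral_restrict[OF assms] unfolding LS_integral_def using r by simp
qed

lemma LS_abs_integral_mono:
  assumes "\<And>x. \<bar>h x\<bar> \<le> \<bar>h' x\<bar>"
  shows "LS_abs_integral t h a \<le> LS_abs_integral t h' a"
  unfolding LS_abs_integral_def using assms
  by (intro add_mono nn_integral_mono ennreal_leI mult_right_mono) (auto simp: indicator_def ennreal_leI)

section \<open>Measurability and localization\<close>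

lemma eq_onI:
  "AE \<omega> in M. \<forall>t. (\<omega>, t) \<in> B \<longrightarrow> X (\<omega>, t) = Y (\<omega>, t) \<Longrightarrow> eq_on M B X Y"
  unfolding eq_on_def indistinguishable_def cut_def by (auto elim: eventually_mono)

text \<open>Here \<open>r\<close> is the minimum of \<open>t\<close> and
  \<open>\<tau> \<omega>\<close> as a real number, which removes extended values from the pathwise
  arguments. The last equation is stated for all \<open>X\<close> because \<open>H\<close>,
  \<open>A\<close> and the integral process are stopped with the same \<open>r\<close>.\<close>

lemma stopping_level:
  fixes \<tau> :: "'a \<Rightarrow> ennreal"
  assumes "0 \<le> t"
  obtains r where "0 \<le> r" "r \<le> t" "ennreal r \<le> \<tau> \<omega>"
    "\<forall>s\<in>{0..t}. ennreal s \<le> \<tau> \<omega> \<longleftrightarrow> s \<le> r"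
    "\<forall>X. \<forall>s\<in>{0..t}. stopped \<tau> X (\<omega>, s) = X (\<omega>, min s r)"
proof (cases "ennreal t \<le> \<tau> \<omega>")
  case True
  have "ennreal s \<le> \<tau> \<omega>" if "s \<in> {0..t}" for s
    using that by (intro order_trans[OF ennreal_leI True]) auto
  then show ?thesis
    using True assms by (intro that[of t]) (auto simp: stopped_def)
next
  case False
  then obtain r where r: "0 \<le> r" "\<tau> \<omega> = ennreal r"
    by (cases "\<tau> \<omega>") auto
  then show ?thesis
    using False assms by (intro that[of r]) (auto simp: stopped_def ennreal_le_iff2 min_def)
qed

section \<open>Stopping and cutting within the classes of processes\<close>

lemma cadlag_stop:
  assumes "cadlag y"
  shows "cadlag (\<lambda>s. y (min s r))"
  unfolding cadlag_def
proof (intro conjI allI impI)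
  fix t :: real assume t: "0 \<le> t"
  show "((\<lambda>s. y (min s r)) \<longlongrightarrow> y (min t r)) (at_right t)"
  proof (cases "t < r")
    case True
    have "\<forall>\<^sub>F s in at_right t. s < r" using True by (auto intro: order_tendstoD)
    then have "\<forall>\<^sub>F s in at_right t. y s = y (min s r)" by eventually_elim simp
    moreover have "(y \<longlongrightarrow> y t) (at_right t)" using assms t by (simp add: cadlag_def)
    ultimately have "((\<lambda>s. y (min s r)) \<longlongrightarrow> y t) (at_right t)"
      by (rule Lim_transform_eventually[rotated])
    then show ?thesis using True by simp
  next
    case False
    have "\<forall>\<^sub>F s in at_right t. t < s" by (simp add: eventually_at_right_less)
    then have "\<forall>\<^sub>F s in at_right t. y (min t r) = y (min s r)"
      by eventually_elim (use False in \<open>simp add: min_def\<close>)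
    then show ?thesis by (rule Lim_transform_eventually[OF tendsto_const])
  qed
next
  fix t :: real assume t: "0 < t"
  show "\<exists>l. ((\<lambda>s. y (min s r)) \<longlongrightarrow> l) (at_left t)"
  \<comment> \<open>For left limits the point \<open>r\<close> belongs to the moving part, for right
    limits to the constant part.\<close>
  proof (cases "t \<le> r")
    case True
    obtain l where l: "(y \<longlongrightarrow> l) (at_left t)" using assms t unfolding cadlag_def by blast
    have "\<forall>\<^sub>F s in at_left t. s \<in> {t - 1<..<t}" by (rule eventually_at_left_real) simp
    then have "\<forall>\<^sub>F s in at_left t. y s = y (min s r)"
      by eventually_elim (use True in \<open>simp add: min_def\<close>)
    with l have "((\<lambda>s. y (min s r)) \<longlongrightarrow> l) (at_left t)"
      by (rule Lim_transform_eventually)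
    then show ?thesis ..
  next
    case False
    have "\<forall>\<^sub>F s in at_left t. r < s" using False by (auto intro: order_tendstoD)
    then have "\<forall>\<^sub>F s in at_left t. y r = y (min s r)"
      by eventually_elim (simp add: min_def)
    then have "((\<lambda>s. y (min s r)) \<longlongrightarrow> y r) (at_left t)"
      by (rule Lim_transform_eventually[OF tendsto_const])
    then show ?thesis ..
  qed
qed

lemma variation_stop_le:
  assumes "0 \<le> r"
  shows "variation (\<lambda>s. y (min s r)) {0..t} \<le> variation y {0..t}"
proof (cases "t \<le> r")
  case True
  then have "variation (\<lambda>s. y (min s r)) {0..t} = variation y {0..t}"
    by (intro variation_cong) (simp add: min_def)
  then show ?thesis by simp
next
  case False
  have "variation (\<lambda>s. y (min s r)) {0..r} = variation y {0..r}"
    by (rule variation_cong) simp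
  moreover have "variation (\<lambda>s. y (min s r)) {r..t} = variation (\<lambda>_. y r) {r..t}"
    by (rule variation_cong) (simp add: min_absorb2)
  ultimately have "variation (\<lambda>s. y (min s r)) {0..t} = variation y {0..r}"
    using False assms variation_Icc_split[of 0 r t "\<lambda>s. y (min s r)"]
    by (simp only: variation_const add_0_right not_le less_imp_le)
  then show ?thesis
    using False variation_mono[of "{0..r}" "{0..t}" y] by simp
qed

lemma cut_measurable_processes:
  assumes Y: "Y \<in> measurable_processes M" and \<tau>: "\<tau> \<in> borel_measurable M"
  shows "cut Y (stoch_Icc M (\<lambda>_. 0) \<tau>) \<in> measurable_processes M"
proof -
  let ?N = "M \<Otimes>\<^sub>M restrict_space borel {0::real..}"
  have [measurable]: "Y \<in> borel_measurable ?N" "\<tau> \<in> borel_measurable M"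
    using Y \<tau> by (simp_all add: measurable_processes_def)
  have [measurable]: "snd \<in> borel_measurable ?N"
    by (rule measurable_compose[OF measurable_snd measurable_restrict_space1[OF measurable_ident_sets[OF refl]]])
  have "(\<lambda>p. if ennreal (snd p) \<le> \<tau> (fst p) then Y p else 0) \<in> borel_measurable ?N"
    by measurable
  then show ?thesis
    unfolding measurable_processes_def
    by (rule measurable_cong[THEN iffD1, rotated])
       (auto simp: cut_def stoch_Icc_def space_pair_measure space_restrict_space)
qed

text \<open>Stopping is composition with the map that replaces the time \<open>t\<close> by the
  minimum of \<open>t\<close> and \<open>\<tau> \<omega>\<close>; joint measurability of
  \<open>Y\<close> does the rest.\<close>

lemma stopped_measurable_processes:
  assumes Y: "Y \<in> measurable_processes M" and \<tau>: "\<tau> \<in> borel_measurable M"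
  shows "stopped \<tau> Y \<in> measurable_processes M"
proof -
  let ?R = "restrict_space borel {0::real..}"
  let ?N = "M \<Otimes>\<^sub>M ?R"
  have [measurable]: "\<tau> \<in> borel_measurable M"
    using \<tau> by simp
  have [measurable]: "snd \<in> borel_measurable ?N"
    by (rule measurable_compose[OF measurable_snd measurable_restrict_space1[OF measurable_ident_sets[OF refl]]])
  have "(\<lambda>p. if ennreal (snd p) \<le> \<tau> (fst p) then snd p else enn2real (\<tau> (fst p))) \<in> borel_measurable ?N"
    by measurable
  \<comment> \<open>\<open>Y\<close> is measurable on nonnegative times, so the new time has to be
    measurable into that subspace.\<close>
  then have "(\<lambda>p. if ennreal (snd p) \<le> \<tau> (fst p) then snd p else enn2real (\<tau> (fst p))) \<in> ?N \<rightarrow>\<^sub>M ?R"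
    by (intro measurable_restrict_space2) (auto simp: space_pair_measure space_restrict_space)
  then have "(\<lambda>p. (fst p, if ennreal (snd p) \<le> \<tau> (fst p) then snd p else enn2real (\<tau> (fst p)))) \<in> ?N \<rightarrow>\<^sub>M ?N"
    by (intro measurable_Pair measurable_fst)
  from measurable_compose[OF this Y[unfolded measurable_processes_def]]
  show ?thesis
    unfolding measurable_processes_def stopped_def
    by (rule measurable_cong[THEN iffD1, rotated]) (auto split: prod.split)
qed

lemma measurable_processes_sections:
  assumes "Y \<in> measurable_processes M"
  shows "process M Y"
    "\<omega> \<in> space M \<Longrightarrow> (\<lambda>s. Y (\<omega>, s)) \<in> borel_measurable (restrict_space borel {0..})"
proof -
  have Y: "Y \<in> borel_measurable (M \<Otimes>\<^sub>M restrict_space borel {0..})"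
    using assms by (simp add: measurable_processes_def)
  show "process M Y"
    unfolding process_def
  proof (intro allI impI)
    fix t :: real assume "0 \<le> t"
    then have "(\<lambda>\<omega>. (\<omega>, t)) \<in> M \<rightarrow>\<^sub>M M \<Otimes>\<^sub>M restrict_space borel {0..}"
      by (intro measurable_Pair2') (simp add: space_restrict_space)
    from measurable_compose[OF this Y] show "(\<lambda>\<omega>. Y (\<omega>, t)) \<in> borel_measurable M" .
  qed
  assume "\<omega> \<in> space M"
  then show "(\<lambda>s. Y (\<omega>, s)) \<in> borel_measurable (restrict_space borel {0..})"
    using measurable_compose[OF measurable_Pair1' Y] by simp
qed

text \<open>The random time is approximated from the right by \<open>(\<lfloor>(n + 1) \<sigma>\<rfloor> + 1) / (n + 1)\<close>.\<close>

lemma measurable_right_cont_at_random_time: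
  assumes Y: "process M Y" and rc: "\<And>\<omega> t. \<omega> \<in> space M \<Longrightarrow> 0 \<le> t \<Longrightarrow> ((\<lambda>s. Y (\<omega>, s)) \<longlongrightarrow> Y (\<omega>, t)) (at_right t)"
    and \<sigma>: "\<sigma> \<in> borel_measurable M" and nonneg: "\<And>\<omega>. 0 \<le> (\<sigma> \<omega> :: real)"
  shows "(\<lambda>\<omega>. Y (\<omega>, \<sigma> \<omega>)) \<in> borel_measurable M"
proof -
  define d where "d n \<omega> = (real (nat \<lfloor>real (Suc n) * \<sigma> \<omega>\<rfloor>) + 1) / real (Suc n)" for n \<omega>
  have d_bounds: "\<sigma> \<omega> < d n \<omega>" "d n \<omega> \<le> \<sigma> \<omega> + 1 / real (Suc n)" for n \<omega>
  proof -
    have "0 \<le> \<lfloor>real (Suc n) * \<sigma> \<omega>\<rfloor>" using nonneg[of \<omega>] by (simp add: mult_nonneg_nonneg)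
    then have e: "real (nat \<lfloor>real (Suc n) * \<sigma> \<omega>\<rfloor>) = of_int \<lfloor>real (Suc n) * \<sigma> \<omega>\<rfloor>" by simp
    have "real (Suc n) * \<sigma> \<omega> < of_int \<lfloor>real (Suc n) * \<sigma> \<omega>\<rfloor> + 1"
      by linarith
    then show "\<sigma> \<omega> < d n \<omega>" unfolding d_def e by (simp add: field_simps)
    have "of_int \<lfloor>real (Suc n) * \<sigma> \<omega>\<rfloor> \<le> real (Suc n) * \<sigma> \<omega>" by linarith
    then have "d n \<omega> \<le> (real (Suc n) * \<sigma> \<omega> + 1) / real (Suc n)"
      unfolding d_def e by (intro divide_right_mono add_right_mono) auto
    then show "d n \<omega> \<le> \<sigma> \<omega> + 1 / real (Suc n)" by (simp add: add_divide_distrib)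
  qed
  \<comment> \<open>For fixed \<open>n\<close> the approximating time takes countably many values,
    so measurability of \<open>Y\<close> at fixed times suffices.\<close>
  have "(\<lambda>\<omega>. Y (\<omega>, d n \<omega>)) \<in> borel_measurable M" for n
    unfolding d_def
  proof (rule measurable_compose_countable[where f = "\<lambda>k \<omega>. Y (\<omega>, (real k + 1) / real (Suc n))"])
    show "(\<lambda>\<omega>. Y (\<omega>, (real k + 1) / real (Suc n))) \<in> borel_measurable M" for k
      using Y unfolding process_def by simp
    show "(\<lambda>\<omega>. nat \<lfloor>real (Suc n) * \<sigma> \<omega>\<rfloor>) \<in> M \<rightarrow>\<^sub>M count_space UNIV"
      using \<sigma> by measurable
  qed
  moreover have "(\<lambda>n. Y (\<omega>, d n \<omega>)) \<longlonglongrightarrow> Y (\<omega>, \<sigma> \<omega>)" if \<omega>: "\<omega> \<in> space M" for \<omega>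
  proof -
    have "(\<lambda>n. d n \<omega>) \<longlonglongrightarrow> \<sigma> \<omega>"
    proof (rule tendsto_sandwich[OF _ _ tendsto_const])
      show "(\<lambda>n. \<sigma> \<omega> + 1 / real (Suc n)) \<longlonglongrightarrow> \<sigma> \<omega>"
        using tendsto_add[OF tendsto_const[of "\<sigma> \<omega>"] LIMSEQ_inverse_real_of_nat]
        by (simp add: inverse_eq_divide)
    qed (use d_bounds in \<open>auto intro!: always_eventually less_imp_le\<close>)
    \<comment> \<open>The filter \<open>at_right\<close> demands the strict inequality
      \<open>\<sigma> \<omega> < d n \<omega>\<close>; this is the reason for the \<open>1\<close>
      added to the floor.\<close>
    then have "filterlim (\<lambda>n. d n \<omega>) (at_right (\<sigma> \<omega>)) sequentially"
      by (intro filterlim_at_withinI always_eventually) (use d_bounds in \<open>auto simp: less_imp_neq[THEN not_sym]\<close>)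
    from filterlim_compose[OF rc[OF \<omega> nonneg] this]
    show ?thesis .
  qed
  ultimately show ?thesis by (rule borel_measurable_LIMSEQ_real[rotated])
qed

text \<open>In contrast to \<open>stopping_level\<close>, this concerns the path at all times at
  once, as statements about \<open>cadlag\<close> and \<open>variation\<close> require.\<close>

lemma stopped_path_cases:
  obtains "(\<lambda>s. stopped \<tau> Y (\<omega>, s)) = (\<lambda>s. Y (\<omega>, s))"
  | r where "0 \<le> r" "\<tau> \<omega> = ennreal r" "(\<lambda>s. stopped \<tau> Y (\<omega>, s)) = (\<lambda>s. Y (\<omega>, min s r))"
proof (cases "\<tau> \<omega>")
  case (real r)
  then show ?thesis by (intro that(2)[of r]) (auto simp: stopped_def ennreal_le_iff2 min_def fun_eq_iff)
next
  case top
  then show ?thesis by (intro that(1)) (auto simp: stopped_def)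
qed

lemma stopped_fv_processes:
  assumes Y: "Y \<in> fv_processes M" and \<tau>: "\<tau> \<in> borel_measurable M"
  shows "stopped \<tau> Y \<in> fv_processes M"
  unfolding fv_processes_def
proof (intro CollectI conjI ballI)
  have Y': "process M Y" "\<And>\<omega>. \<omega> \<in> space M \<Longrightarrow> cadlag (\<lambda>t. Y (\<omega>, t))"
    "\<And>\<omega> t. \<omega> \<in> space M \<Longrightarrow> 0 \<le> t \<Longrightarrow> variation (\<lambda>s. Y (\<omega>, s)) {0..t} < top"
    using Y by (auto simp: fv_processes_def)
  show "process M (stopped \<tau> Y)"
    unfolding process_def
  proof (intro allI impI)
    fix t :: real assume t: "0 \<le> t"
    \<comment> \<open>The stopped process at time \<open>t\<close> is \<open>Y\<close> at this
      finite random time, where right-continuity gives measurability.\<close>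
    define \<sigma> where "\<sigma> \<omega> = (if ennreal t \<le> \<tau> \<omega> then t else enn2real (\<tau> \<omega>))" for \<omega>
    have "\<sigma> \<in> borel_measurable M" unfolding \<sigma>_def using \<tau> by measurable
    moreover have "0 \<le> \<sigma> \<omega>" for \<omega> unfolding \<sigma>_def using t by simp
    ultimately have "(\<lambda>\<omega>. Y (\<omega>, \<sigma> \<omega>)) \<in> borel_measurable M"
      using Y'(1,2) by (intro measurable_right_cont_at_random_time) (auto simp: cadlag_def)
    moreover have "(\<lambda>\<omega>. Y (\<omega>, \<sigma> \<omega>)) = (\<lambda>\<omega>. stopped \<tau> Y (\<omega>, t))"
      by (auto simp: \<sigma>_def stopped_def)
    ultimately show "(\<lambda>\<omega>. stopped \<tau> Y (\<omega>, t)) \<in> borel_measurable M" by simp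
  qed
  fix \<omega> assume \<omega>: "\<omega> \<in> space M"
  show "cadlag (\<lambda>t. stopped \<tau> Y (\<omega>, t))"
    by (cases rule: stopped_path_cases[of \<tau> Y \<omega>]) (use Y'(2)[OF \<omega>] cadlag_stop[OF Y'(2)[OF \<omega>]] in auto)
  show "\<forall>t\<ge>0. variation (\<lambda>s. stopped \<tau> Y (\<omega>, s)) {0..t} < top"
    by (cases rule: stopped_path_cases[of \<tau> Y \<omega>])
       (use Y'(3)[OF \<omega>] in \<open>auto intro: le_less_trans[OF variation_stop_le]\<close>)
qed

section \<open>Stopping times, predictable sets of interval type and coupled sequences\<close>

context usual_filtration
begin

lemma is_stopping_time_measurable:
  assumes "is_stopping_time M F T"
  shows "T \<in> borel_measurable M"
proof (rule borel_measurableI_le)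
  fix t :: ennreal
  show "{\<omega> \<in> space M. T \<omega> \<le> t} \<in> sets M"
  proof (cases "t = top")
    case False
    have "Measurable.pred (extend_filtration M F t) (\<lambda>\<omega>. T \<omega> \<le> t)"
      using assms unfolding is_stopping_time_def by (rule stopping_timeD)
    then have "{\<omega> \<in> space (F (enn2real t)). T \<omega> \<le> t} \<in> sets (F (enn2real t))"
      using False by (simp add: extend_filtration_def pred_def)
    then show ?thesis
      using subalgebra_F[of "enn2real t"] by (auto simp: subalgebra_def)
  qed simp
qed

text \<open>Preimages under \<open>f\<close> and \<open>g\<close> differ within a null set, all of
  whose subsets belong to \<open>F 0\<close> and hence to \<open>M\<close>.\<close>

lemma measurable_AE_eq:
  fixes f g :: "'a \<Rightarrow> real"
  assumes f: "f \<in> borel_measurable M" and eq: "AE \<omega> in M. f \<omega> = g \<omega>"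
  shows "g \<in> borel_measurable M"
proof (rule measurableI)
  fix A :: "real set" assume A: "A \<in> sets borel"
  obtain N where N: "N \<in> null_sets M" "{\<omega> \<in> space M. f \<omega> \<noteq> g \<omega>} \<subseteq> N"
    using eq unfolding eventually_ae_filter by auto
  have "g -` A \<inter> space M = (f -` A \<inter> space M - N) \<union> (g -` A \<inter> space M \<inter> N)"
    using N(2) by auto
  moreover have "f -` A \<inter> space M - N \<in> sets M"
    using f A N(1) by auto
  moreover have "g -` A \<inter> space M \<inter> N \<in> sets M"
    using complete_F[OF N(1)] subalgebra_F[of 0] by (auto simp: subalgebra_def)
  ultimately show "g -` A \<inter> space M \<in> sets M" by (metis sets.Un)
qed simp

text \<open>The map from \<open>\<omega>\<close> to \<open>(\<omega>, t)\<close> is measurable into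
  the predictable sigma-algebra: every generator is a rectangle, whose preimage is its base or
  empty.\<close>

lemma PSIT_section_measurable:
  assumes B: "PSIT M F B" and t: "0 \<le> t"
  shows "{\<omega> \<in> space M. (\<omega>, t) \<in> B} \<in> sets M"
proof -
  have F_sets: "C \<in> sets (F s) \<Longrightarrow> 0 \<le> s \<Longrightarrow> C \<in> sets M" for C s
    using subalgebra_F[of s] by (auto simp: subalgebra_def)
  then have F_space: "a \<in> C \<Longrightarrow> C \<in> sets (F s) \<Longrightarrow> 0 \<le> s \<Longrightarrow> a \<in> space M" for a C s
    by (meson sets.sets_into_space subsetD)
  have "(\<lambda>\<omega>. (\<omega>, t)) \<in> M \<rightarrow>\<^sub>M predictable_sigma M F"
    unfolding predictable_sigma_def
  proof (rule measurable_measure_of)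
    show "{C \<times> {0} |C. C \<in> sets (F 0)} \<union>
      {C \<times> {s<..t} |C s t. 0 \<le> s \<and> s \<le> t \<and> C \<in> sets (F s)} \<subseteq> Pow (space M \<times> {0..})"
      by (auto intro: F_space)
    show "(\<lambda>\<omega>. (\<omega>, t)) \<in> space M \<rightarrow> space M \<times> {0..}" using t by auto
    fix y assume "y \<in> {C \<times> {0} |C. C \<in> sets (F 0)} \<union>
      {C \<times> {s<..t} |C s t. 0 \<le> s \<and> s \<le> t \<and> C \<in> sets (F s)}"
    then consider C where "C \<in> sets (F 0)" "y = C \<times> {0}"
      | C u v where "0 \<le> u" "C \<in> sets (F u)" "y = C \<times> {u<..v}"
      by blast
    then obtain C R where "C \<in> sets M" and y: "y = C \<times> R"
    proof cases
      case (1 C)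
      then show ?thesis using F_sets[of C 0] by (intro that[of C "{0}"]) auto
    next
      case (2 C u v)
      then show ?thesis using F_sets[of C u] by (intro that[of C "{u<..v}"]) auto
    qed
    moreover have "(\<lambda>\<omega>. (\<omega>, t)) -` y \<inter> space M = (if t \<in> R then C \<inter> space M else {})"
      using y by auto
    ultimately show "(\<lambda>\<omega>. (\<omega>, t)) -` y \<inter> space M \<in> sets M" by simp
  qed
  from measurable_sets[OF this] B show ?thesis
    by (auto simp: PSIT_def vimage_def Int_def conj_commute)
qed

lemma PSIT_subset:
  assumes "PSIT M F B" "(\<omega>, t) \<in> B"
  shows "\<omega> \<in> space M \<and> 0 \<le> t"
proof -
  have "space (predictable_sigma M F) = space M \<times> {0..}"
    unfolding predictable_sigma_def by (rule space_measure_of_conv)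
  moreover have "B \<subseteq> space (predictable_sigma M F)"
    using assms(1) unfolding PSIT_def by (intro sets.sets_into_space) simp
  ultimately show ?thesis using assms(2) by auto
qed

lemma PSIT_interval:
  assumes B: "PSIT M F B" and t: "(\<omega>, t) \<in> B" and s: "0 \<le> s" "s \<le> t"
  shows "(\<omega>, s) \<in> B"
proof -
  have "\<omega> \<in> space M" using PSIT_subset[OF B t] by simp
  then obtain T where "{t. (\<omega>, t) \<in> B} = {t. 0 \<le> t \<and> ennreal t < T \<omega>} \<or>
            {t. (\<omega>, t) \<in> B} = {t. 0 \<le> t \<and> ennreal t \<le> T \<omega>}"
    using B unfolding PSIT_def by auto
  moreover have "t \<in> {t. (\<omega>, t) \<in> B}" using t by simp
  ultimately have "s \<in> {t. (\<omega>, t) \<in> B}"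
    using s order_trans[OF ennreal_leI[OF s(2)]] le_less_trans[OF ennreal_leI[OF s(2)]]
    by (auto simp: set_eq_iff)
  then show ?thesis by simp
qed

text \<open>For fixed \<open>t\<close> and outside a null set, the cut approximations are eventually
  constant in \<open>n\<close> with value \<open>cut X B\<close>. This supplies the condition
  \<open>process_on\<close> for the stopped and cut processes.\<close>

lemma coupled_sequence_process_on:
  assumes B: "PSIT M F B" and CS: "coupled_sequence M F B X T Y"
  shows "process_on M B X"
  unfolding process_on_def process_def
proof (intro allI impI)
  fix t :: real assume t: "0 \<le> t"
  define f where "f n \<omega> = (if (\<omega>, t) \<in> B \<and> ennreal t \<le> T n \<omega> then Y n (\<omega>, t) else 0)" for n \<omega>
  have T: "T n \<in> borel_measurable M" for n
    using CS is_stopping_time_measurable unfolding coupled_sequence_def by blast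
  have Yt: "(\<lambda>\<omega>. Y n (\<omega>, t)) \<in> borel_measurable M" for n
    using CS t unfolding coupled_sequence_def process_def by blast
  have "Measurable.pred M (\<lambda>\<omega>. (\<omega>, t) \<in> B)"
    unfolding pred_def by (rule PSIT_section_measurable[OF B t])
  then have f: "f n \<in> borel_measurable M" for n
    unfolding f_def using T[of n] Yt[of n] by measurable
  have ae: "AE \<omega> in M. \<forall>n. \<forall>t\<ge>0. cut X (B \<inter> stoch_Icc M (\<lambda>_. 0) (T n)) (\<omega>, t) =
      cut (Y n) (B \<inter> stoch_Icc M (\<lambda>_. 0) (T n)) (\<omega>, t)"
    using CS unfolding coupled_sequence_def indistinguishable_def AE_all_countable by blast
  \<comment> \<open>The function given by \<open>lim\<close> is measurable even where the sequence
    diverges, so the null set enters only the comparison with \<open>X\<close>.\<close>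
  have "AE \<omega> in M. lim (\<lambda>n. f n \<omega>) = cut X B (\<omega>, t)"
    using ae AE_space
  proof eventually_elim
    case (elim \<omega>)
    have "(\<lambda>n. f n \<omega>) \<longlonglongrightarrow> cut X B (\<omega>, t)"
    proof (cases "(\<omega>, t) \<in> B")
      case True
      then obtain N where N: "ennreal t \<le> T N \<omega>"
        using CS unfolding coupled_sequence_def stoch_Icc_def by blast
      have "incseq (\<lambda>n. T n \<omega>)" using CS elim(2) unfolding coupled_sequence_def by blast
      then have "ennreal t \<le> T n \<omega>" if "N \<le> n" for n
        using N that by (meson incseqD order_trans)
      then have "cut X B (\<omega>, t) = f n \<omega>" if "N \<le> n" for n
        using elim(1)[rule_format, OF t, of n] that True elim(2) t
        by (simp add: f_def cut_def stoch_Icc_def)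
      then have "\<forall>\<^sub>F n in sequentially. cut X B (\<omega>, t) = f n \<omega>"
        by (auto simp: eventually_sequentially)
      then show ?thesis by (rule Lim_transform_eventually[OF tendsto_const])
    qed (simp add: f_def cut_def)
    then show ?case by (rule limI)
  qed
  then show "(\<lambda>\<omega>. cut X B (\<omega>, t)) \<in> borel_measurable M"
    by (rule measurable_AE_eq[rotated]) (intro borel_measurable_lim_metric f)
qed

text \<open>A stochastic interval from \<open>0\<close> that contains \<open>(\<omega>, t)\<close>
  contains all earlier times, so one member of the sequence matches \<open>X\<close> on all of
  \<open>[0, t]\<close>. The path regularity of \<open>H\<close> and \<open>A\<close> is drawn from
  here.\<close>

lemma localized_agree:
  assumes B: "PSIT M F B" and X: "X \<in> localized M F B D"
  shows "AE \<omega> in M. \<forall>t. (\<omega>, t) \<in> B \<longrightarrow> (\<exists>Y\<in>D. \<forall>s\<in>{0..t}. X (\<omega>, s) = Y (\<omega>, s))"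
proof -
  obtain T Y where CS: "coupled_sequence M F B X T Y" and D: "\<And>n. Y n \<in> D"
    using X unfolding localized_def by blast
  have ae: "AE \<omega> in M. \<forall>n. \<forall>t\<ge>0. cut X (B \<inter> stoch_Icc M (\<lambda>_. 0) (T n)) (\<omega>, t) =
      cut (Y n) (B \<inter> stoch_Icc M (\<lambda>_. 0) (T n)) (\<omega>, t)"
    using CS unfolding coupled_sequence_def indistinguishable_def AE_all_countable by blast
  then show ?thesis
    using AE_space
  proof eventually_elim
    case (elim \<omega>)
    show ?case
    proof (intro allI impI)
      fix t assume t: "(\<omega>, t) \<in> B"
      then obtain n where n: "ennreal t \<le> T n \<omega>"
        using CS unfolding coupled_sequence_def stoch_Icc_def by blast
      have "X (\<omega>, s) = Y n (\<omega>, s)" if "s \<in> {0..t}" for s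
      proof -
        have "ennreal s \<le> T n \<omega>" using that by (intro order_trans[OF ennreal_leI n]) auto
        then show ?thesis
          using elim(1)[rule_format, of s n] elim(2) PSIT_interval[OF B t, of s] that
          by (simp add: cut_def stoch_Icc_def)
      qed
      then show "\<exists>Y\<in>D. \<forall>s\<in>{0..t}. X (\<omega>, s) = Y (\<omega>, s)" using D by blast
    qed
  qed
qed

text \<open>An operation whose value at time \<open>t\<close> depends only on the path up to
  \<open>t\<close> can be applied to each member of a coupled sequence while the stopping times are
  kept. The last assumption expresses this dependence; stopping and cutting are the two
  instances.\<close>

lemma localized_map:
  assumes B: "PSIT M F B" and X: "X \<in> localized M F B D"
    and \<Phi>: "\<And>Y. Y \<in> D \<Longrightarrow> \<Phi> Y \<in> D" and D: "\<And>Y. Y \<in> D \<Longrightarrow> process M Y"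
    and X': "\<And>Y \<omega> t. (\<omega>, t) \<in> B \<Longrightarrow> (\<And>s. s \<in> {0..t} \<Longrightarrow> X (\<omega>, s) = Y (\<omega>, s)) \<Longrightarrow> X' (\<omega>, t) = \<Phi> Y (\<omega>, t)"
  shows "X' \<in> localized M F B D"
proof -
  obtain T Y where CS: "coupled_sequence M F B X T Y" and YD: "\<And>n. Y n \<in> D"
    using X unfolding localized_def by blast
  have "indistinguishable M (cut X' (B \<inter> stoch_Icc M (\<lambda>_. 0) (T n))) (cut (\<Phi> (Y n)) (B \<inter> stoch_Icc M (\<lambda>_. 0) (T n)))" for n
  proof -
    have "AE \<omega> in M. \<forall>t\<ge>0. cut X (B \<inter> stoch_Icc M (\<lambda>_. 0) (T n)) (\<omega>, t) =
        cut (Y n) (B \<inter> stoch_Icc M (\<lambda>_. 0) (T n)) (\<omega>, t)"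
      using CS unfolding coupled_sequence_def indistinguishable_def by blast
    then show ?thesis
      unfolding indistinguishable_def
    proof eventually_elim
      case (elim \<omega>)
      show ?case
      proof (intro allI impI)
        fix t :: real assume "0 \<le> t"
        have "X' (\<omega>, t) = \<Phi> (Y n) (\<omega>, t)" if t: "(\<omega>, t) \<in> B" "(\<omega>, t) \<in> stoch_Icc M (\<lambda>_. 0) (T n)"
        proof (rule X'[OF t(1)])
          fix s assume s: "s \<in> {0..t}"
          have "ennreal t \<le> T n \<omega>" "\<omega> \<in> space M" using t(2) by (auto simp: stoch_Icc_def)
          moreover from this have "ennreal s \<le> T n \<omega>"
            using s by (intro order_trans[OF ennreal_leI \<open>ennreal t \<le> T n \<omega>\<close>]) auto
          ultimately show "X (\<omega>, s) = Y n (\<omega>, s)"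
            using elim[rule_format, of s] PSIT_interval[OF B t(1), of s] s
            by (simp add: cut_def stoch_Icc_def)
        qed
        then show "cut X' (B \<inter> stoch_Icc M (\<lambda>_. 0) (T n)) (\<omega>, t) =
            cut (\<Phi> (Y n)) (B \<inter> stoch_Icc M (\<lambda>_. 0) (T n)) (\<omega>, t)"
          by (simp add: cut_def)
      qed
    qed
  qed
  then have "coupled_sequence M F B X' T (\<lambda>n. \<Phi> (Y n))"
    using CS \<Phi> D YD unfolding coupled_sequence_def by blast
  then show ?thesis
    using coupled_sequence_process_on[OF B] \<Phi> YD unfolding localized_def by blast
qed

lemma localized_stopped:
  assumes B: "PSIT M F B" and X: "X \<in> localized M F B D"
    and st: "\<And>Y. Y \<in> D \<Longrightarrow> stopped \<tau> Y \<in> D" and D: "\<And>Y. Y \<in> D \<Longrightarrow> process M Y"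
  shows "restrict (stopped \<tau> X) B \<in> localized M F B D"
proof (rule localized_map[OF B X st D])
  fix Y \<omega> t assume t: "(\<omega>, t) \<in> B" and eq: "\<And>s. s \<in> {0..t} \<Longrightarrow> X (\<omega>, s) = Y (\<omega>, s)"
  have "0 \<le> t" using PSIT_subset[OF B t] by simp
  then obtain r where r: "0 \<le> r" "r \<le> t" "ennreal r \<le> \<tau> \<omega>"
    "\<forall>s\<in>{0..t}. ennreal s \<le> \<tau> \<omega> \<longleftrightarrow> s \<le> r"
    "\<forall>X. \<forall>s\<in>{0..t}. stopped \<tau> X (\<omega>, s) = X (\<omega>, min s r)"
    by (rule stopping_level[of t \<tau> \<omega>])
  have "restrict (stopped \<tau> X) B (\<omega>, t) = X (\<omega>, min t r)" "stopped \<tau> Y (\<omega>, t) = Y (\<omega>, min t r)"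
    using r(5) t \<open>0 \<le> t\<close> by auto
  then show "restrict (stopped \<tau> X) B (\<omega>, t) = stopped \<tau> Y (\<omega>, t)"
    using eq[of "min t r"] r(1,2) by simp
qed

end

section \<open>Integral processes\<close>

text \<open>The function is \<open>h\<close> on \<open>{0<..r}\<close> and the constant
  \<open>h r\<close> on \<open>{r<..t}\<close>.\<close>

lemma set_borel_measurable_stop:
  fixes h :: "real \<Rightarrow> real"
  assumes h: "set_borel_measurable borel {0<..t} h" and r: "0 \<le> r" "r \<le> t"
  shows "set_borel_measurable borel {0<..t} (\<lambda>s. h (min s r))"
proof -
  have "set_borel_measurable borel {0<..r} h"
    by (rule set_borel_measurable_subset[OF h]) (use r in auto)
  then have "(\<lambda>x. indicat_real {0<..r} x *\<^sub>R h x + indicat_real {r<..t} x * h r) \<in> borel_measurable borel"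
    unfolding set_borel_measurable_def by measurable
  moreover have "(\<lambda>x. indicat_real {0<..r} x *\<^sub>R h x + indicat_real {r<..t} x * h r) =
      (\<lambda>x. indicat_real {0<..t} x *\<^sub>R h (min x r))"
    using r by (auto simp: fun_eq_iff indicator_def min_def)
  ultimately show ?thesis unfolding set_borel_measurable_def by simp
qed

context usual_filtration
begin

lemma AE_regular_paths:
  assumes B: "PSIT M F B" and H: "H \<in> localized M F B (measurable_processes M)"
    and A: "A \<in> localized M F B (fv_processes M)"
  shows "AE \<omega> in M. \<forall>t. (\<omega>, t) \<in> B \<longrightarrow>
    rc_bv_path (ext_path t (\<lambda>s. A (\<omega>, s))) \<and>
    set_borel_measurable borel {0<..t} (\<lambda>s. H (\<omega>, s)) \<and>
    (0 < t \<longrightarrow> (\<exists>l. ((\<lambda>s. A (\<omega>, s)) \<longlongrightarrow> l) (at_left t)))"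
  using localized_agree[OF B H] localized_agree[OF B A] AE_space
proof eventually_elim
  case (elim \<omega>)
  show ?case
  proof (intro allI impI conjI)
    fix t assume tB: "(\<omega>, t) \<in> B"
    have t: "0 \<le> t" using PSIT_subset[OF B tB] by simp
    obtain Y where Y: "Y \<in> fv_processes M" "\<And>s. s \<in> {0..t} \<Longrightarrow> A (\<omega>, s) = Y (\<omega>, s)"
      using elim(2) tB by blast
    obtain G where G: "G \<in> measurable_processes M" "\<And>s. s \<in> {0..t} \<Longrightarrow> H (\<omega>, s) = G (\<omega>, s)"
      using elim(1) tB by blast
    have y: "cadlag (\<lambda>s. Y (\<omega>, s))" "variation (\<lambda>s. Y (\<omega>, s)) {0..t} < top"
      using Y(1) elim(3) t by (auto simp: fv_processes_def)
    have "ext_path t (\<lambda>s. A (\<omega>, s)) = ext_path t (\<lambda>s. Y (\<omega>, s))"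
      by (rule ext_path_cong) (use Y(2) t in auto)
    then show "rc_bv_path (ext_path t (\<lambda>s. A (\<omega>, s)))"
      using rc_bv_path_ext_path[OF y t] by simp
    have "(\<lambda>s. G (\<omega>, s)) \<in> borel_measurable (restrict_space borel {0..})"
      by (rule measurable_processes_sections(2)[OF G(1) elim(3)])
    \<comment> \<open>The section of \<open>G\<close> is Borel on the half-line; it is continued by
      zero and then cut to \<open>{0<..t}\<close>, where it equals that of \<open>H\<close>.\<close>
    then have "(\<lambda>s. indicat_real {0..} s *\<^sub>R G (\<omega>, s)) \<in> borel_measurable borel"
      by (subst (asm) borel_measurable_restrict_space_iff) auto
    then have "(\<lambda>s. indicat_real {0<..t} s *\<^sub>R (indicat_real {0..} s *\<^sub>R G (\<omega>, s))) \<in> borel_measurable borel"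
      by measurable
    moreover have "(\<lambda>s. indicat_real {0<..t} s *\<^sub>R (indicat_real {0..} s *\<^sub>R G (\<omega>, s))) =
        (\<lambda>s. indicat_real {0<..t} s *\<^sub>R H (\<omega>, s))"
      using G(2) by (auto simp: fun_eq_iff indicator_def)
    ultimately show "set_borel_measurable borel {0<..t} (\<lambda>s. H (\<omega>, s))"
      unfolding set_borel_measurable_def by simp
    assume t0: "0 < t"
    obtain l where l: "((\<lambda>s. Y (\<omega>, s)) \<longlongrightarrow> l) (at_left t)"
      using y(1) t0 unfolding cadlag_def by blast
    have "\<forall>\<^sub>F s in at_left t. Y (\<omega>, s) = A (\<omega>, s)"
      using eventually_at_left_real[OF t0] by eventually_elim (simp add: Y(2))
    from Lim_transform_eventually[OF l this] show "\<exists>l. ((\<lambda>s. A (\<omega>, s)) \<longlongrightarrow> l) (at_left t)" ..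
  qed
qed

lemma AE_LS_process_left_limit:
  assumes B: "PSIT M F B" and int: "integrable_on_wrt M F B H A"
  shows "AE \<omega> in M. \<forall>t>0. (\<omega>, t) \<in> B \<longrightarrow> (\<exists>l. ((\<lambda>s. A (\<omega>, s)) \<longlongrightarrow> l) (at_left t) \<and>
    ((\<lambda>s. LS_process B H A (\<omega>, s)) \<longlongrightarrow>
       LS_process B H A (\<omega>, t) - H (\<omega>, t) * (A (\<omega>, t) - l)) (at_left t))"
proof -
  have "AE \<omega> in M. \<forall>t. (\<omega>, t) \<in> B \<longrightarrow> LS_abs_integral t (\<lambda>s. H (\<omega>, s)) (\<lambda>s. A (\<omega>, s)) < top"
    "H \<in> localized M F B (measurable_processes M)" "A \<in> localized M F B (fv_processes M)"
    using int unfolding integrable_on_wrt_def by auto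
  from this(1) AE_regular_paths[OF B this(2,3)] show ?thesis
  proof eventually_elim
    case (elim \<omega>)
    show ?case
    proof (intro allI impI)
      fix t :: real assume t: "0 < t" and tB: "(\<omega>, t) \<in> B"
      have sB: "(\<omega>, s) \<in> B" if "0 \<le> s" "s \<le> t" for s using PSIT_interval[OF B tB that] .
      obtain l where l: "((\<lambda>s. A (\<omega>, s)) \<longlongrightarrow> l) (at_left t)" using elim(2) tB t by blast
      have "((\<lambda>s. LS_integral s (\<lambda>s. H (\<omega>, s)) (\<lambda>s. A (\<omega>, s))) \<longlongrightarrow>
        LS_integral t (\<lambda>s. H (\<omega>, s)) (\<lambda>s. A (\<omega>, s)) - H (\<omega>, t) * (A (\<omega>, t) - l)) (at_left t)"
        by (rule LS_integral_tendsto_at_left) (use elim tB sB t l in blast)+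
      \<comment> \<open>Off \<open>B\<close> the values of \<open>LS_process\<close> are
        \<open>undefined\<close>; since \<open>B\<close> contains all of \<open>[0, t]\<close>, they
        are the integrals on the left of \<open>t\<close>.\<close>
      moreover have "\<forall>\<^sub>F s in at_left t. LS_integral s (\<lambda>s. H (\<omega>, s)) (\<lambda>s. A (\<omega>, s)) = LS_process B H A (\<omega>, s)"
        using eventually_at_left_real[OF t] by eventually_elim (simp add: LS_process_def sB)
      ultimately have "((\<lambda>s. LS_process B H A (\<omega>, s)) \<longlongrightarrow>
        LS_integral t (\<lambda>s. H (\<omega>, s)) (\<lambda>s. A (\<omega>, s)) - H (\<omega>, t) * (A (\<omega>, t) - l)) (at_left t)"
        by (rule Lim_transform_eventually)
      with l tB show "\<exists>l. ((\<lambda>s. A (\<omega>, s)) \<longlongrightarrow> l) (at_left t) \<and> ((\<lambda>s. LS_process B H A (\<omega>, s)) \<longlongrightarrow>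
         LS_process B H A (\<omega>, t) - H (\<omega>, t) * (A (\<omega>, t) - l)) (at_left t)"
        by (auto simp: LS_process_def)
    qed
  qed
qed

text \<open>The integrals over the empty interval \<open>{0<..0}\<close> vanish and the mass at
  \<open>0\<close> remains; \<open>(\<omega>, 0)\<close> lies in \<open>B\<close> because sections
  are nonempty intervals.\<close>

lemma LS_process_at_zero:
  assumes B: "PSIT M F B"
  shows "indistinguishable M (cut (LS_process B H A) (stoch_Icc M (\<lambda>_. 0) (\<lambda>_. 0)))
     (cut (\<lambda>p. H p * A p) (stoch_Icc M (\<lambda>_. 0) (\<lambda>_. 0)))"
proof -
  have "(\<omega>, 0) \<in> B" if \<omega>: "\<omega> \<in> space M" for \<omega>
  proof -
    obtain t where t: "(\<omega>, t) \<in> B" using B \<omega> unfolding PSIT_def by blast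
    show ?thesis using PSIT_interval[OF B t, of 0] PSIT_subset[OF B t] by simp
  qed
  then have "cut (LS_process B H A) (stoch_Icc M (\<lambda>_. 0) (\<lambda>_. 0)) (\<omega>, t) =
      cut (\<lambda>p. H p * A p) (stoch_Icc M (\<lambda>_. 0) (\<lambda>_. 0)) (\<omega>, t)" for \<omega> t
    by (auto simp: cut_def stoch_Icc_def LS_process_def LS_integral_def set_lebesgue_integral_def)
  then show ?thesis unfolding indistinguishable_def by simp
qed

lemma LS_process_left_limits_and_jump:
  assumes B: "PSIT M F B" and int: "integrable_on_wrt M F B H A"
  shows "has_left_limits_on M B (LS_process B H A)"
    "eq_on M B (jump (LS_process B H A)) (\<lambda>p. H p * jump A p)"
proof -
  note lim = AE_LS_process_left_limit[OF B int]
  show "has_left_limits_on M B (LS_process B H A)"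
    unfolding has_left_limits_on_def using lim by eventually_elim blast
  show "eq_on M B (jump (LS_process B H A)) (\<lambda>p. H p * jump A p)"
  proof (rule eq_onI, use lim in eventually_elim, intro allI impI)
    fix \<omega> t
    assume elim: "\<forall>t>0. (\<omega>, t) \<in> B \<longrightarrow> (\<exists>l. ((\<lambda>s. A (\<omega>, s)) \<longlongrightarrow> l) (at_left t) \<and>
       ((\<lambda>s. LS_process B H A (\<omega>, s)) \<longlongrightarrow>
         LS_process B H A (\<omega>, t) - H (\<omega>, t) * (A (\<omega>, t) - l)) (at_left t))"
      and tB: "(\<omega>, t) \<in> B"
    show "jump (LS_process B H A) (\<omega>, t) = H (\<omega>, t) * jump A (\<omega>, t)"
    \<comment> \<open>At \<open>t = 0\<close> both jumps vanish by the convention in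
      \<open>left_lim\<close>; otherwise the two limits just found evaluate
      \<open>Lim\<close>.\<close>
    proof (cases "t = 0")
      case False
      then have "0 < t" using PSIT_subset[OF B tB] by simp
      with elim tB obtain l where l: "((\<lambda>s. A (\<omega>, s)) \<longlongrightarrow> l) (at_left t)"
        "((\<lambda>s. LS_process B H A (\<omega>, s)) \<longlongrightarrow>
           LS_process B H A (\<omega>, t) - H (\<omega>, t) * (A (\<omega>, t) - l)) (at_left t)"
        by blast
      show ?thesis
        using tendsto_Lim[OF trivial_limit_at_left_real l(1)] tendsto_Lim[OF trivial_limit_at_left_real l(2)] False
        by (simp add: jump_def left_lim_def)
    qed (simp add: jump_def left_lim_def)
  qed
qed

lemma AE_LS_stopped:
  assumes B: "PSIT M F B" and int: "integrable_on_wrt M F B H A" and \<tau>: "stopping_time_on M F B \<tau>"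
  shows "AE \<omega> in M. \<forall>t. (\<omega>, t) \<in> B \<longrightarrow>
    LS_abs_integral t (\<lambda>s. H (\<omega>, s)) (\<lambda>s. restrict (stopped \<tau> A) B (\<omega>, s)) < top \<and>
    LS_abs_integral t (\<lambda>s. restrict (stopped \<tau> H) B (\<omega>, s)) (\<lambda>s. restrict (stopped \<tau> A) B (\<omega>, s)) < top \<and>
    LS_abs_integral t (\<lambda>s. restrict (cut H (stoch_Icc M (\<lambda>_. 0) \<tau>)) B (\<omega>, s)) (\<lambda>s. A (\<omega>, s)) < top \<and>
    restrict (stopped \<tau> (LS_process B H A)) B (\<omega>, t) = LS_process B H (restrict (stopped \<tau> A) B) (\<omega>, t) \<and>
    LS_process B H (restrict (stopped \<tau> A) B) (\<omega>, t) =
      LS_process B (restrict (stopped \<tau> H) B) (restrict (stopped \<tau> A) B) (\<omega>, t) \<and>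
    LS_process B (restrict (stopped \<tau> H) B) (restrict (stopped \<tau> A) B) (\<omega>, t) =
      LS_process B (restrict (cut H (stoch_Icc M (\<lambda>_. 0) \<tau>)) B) A (\<omega>, t)"
proof -
  have "AE \<omega> in M. \<forall>t. (\<omega>, t) \<in> B \<longrightarrow> LS_abs_integral t (\<lambda>s. H (\<omega>, s)) (\<lambda>s. A (\<omega>, s)) < top"
    "H \<in> localized M F B (measurable_processes M)" "A \<in> localized M F B (fv_processes M)"
    using int unfolding integrable_on_wrt_def by auto
  from this(1) AE_regular_paths[OF B this(2,3)] show ?thesis
  proof (eventually_elim, intro allI impI)
    fix \<omega> t
    assume fin: "\<forall>t. (\<omega>, t) \<in> B \<longrightarrow> LS_abs_integral t (\<lambda>s. H (\<omega>, s)) (\<lambda>s. A (\<omega>, s)) < top"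
      and reg: "\<forall>t. (\<omega>, t) \<in> B \<longrightarrow> rc_bv_path (ext_path t (\<lambda>s. A (\<omega>, s))) \<and>
          set_borel_measurable borel {0<..t} (\<lambda>s. H (\<omega>, s)) \<and>
          (0 < t \<longrightarrow> (\<exists>l. ((\<lambda>s. A (\<omega>, s)) \<longlongrightarrow> l) (at_left t)))"
      and tB: "(\<omega>, t) \<in> B"
    define h a where "h s = H (\<omega>, s)" and "a s = A (\<omega>, s)" for s
    have t: "0 \<le> t" "\<omega> \<in> space M" using PSIT_subset[OF B tB] by auto
    obtain r where r: "0 \<le> r" "r \<le> t" "ennreal r \<le> \<tau> \<omega>"
      "\<forall>s\<in>{0..t}. ennreal s \<le> \<tau> \<omega> \<longleftrightarrow> s \<le> r"
      "\<forall>X. \<forall>s\<in>{0..t}. stopped \<tau> X (\<omega>, s) = X (\<omega>, min s r)"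
      by (rule stopping_level[OF t(1)])
    have sB: "(\<omega>, s) \<in> B" if "s \<in> {0..t}" for s using PSIT_interval[OF B tB] that by simp
    have rB: "(\<omega>, r) \<in> B" using sB r(1,2) by simp
    have paths: "rc_bv_path (ext_path r a)" "rc_bv_path (ext_path t a)"
      and h: "set_borel_measurable borel {0<..t} h"
      using reg rB tB unfolding h_def[abs_def] a_def[abs_def] by auto
    have fin': "LS_abs_integral r h a < top" "LS_abs_integral t h a < top"
      using fin rB tB unfolding h_def[abs_def] a_def[abs_def] by auto
    let ?hs = "\<lambda>s. restrict (stopped \<tau> H) B (\<omega>, s)" and ?as = "\<lambda>s. restrict (stopped \<tau> A) B (\<omega>, s)"
      and ?hc = "\<lambda>s. restrict (cut H (stoch_Icc M (\<lambda>_. 0) \<tau>)) B (\<omega>, s)"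
    have hs: "?hs s = h (min s r)" and as: "?as s = a (min s r)"
      and hc: "?hc s = (if s \<le> r then h s else 0)" if s: "s \<in> {0..t}" for s
      using r(4,5) s sB[OF s] t(2) by (auto simp: h_def a_def cut_def stoch_Icc_def)
    have abs1: "LS_abs_integral t h ?as = LS_abs_integral r h a"
      using LS_abs_integral_cong[OF t(1), of h h ?as "\<lambda>s. a (min s r)"] as
        LS_abs_integral_stop_integrator[OF paths(1) r(1,2)] by simp
    \<comment> \<open>Once the stopped integrator has shortened the horizon to \<open>r\<close>,
      stopping the integrand changes nothing, since \<open>min s r = s\<close> on
      \<open>[0, r]\<close>.\<close>
    have "LS_abs_integral t ?hs ?as = LS_abs_integral r (\<lambda>s. h (min s r)) a"
      using LS_abs_integral_cong[OF t(1), of ?hs "\<lambda>s. h (min s r)" ?as "\<lambda>s. a (min s r)"] hs as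
        LS_abs_integral_stop_integrator[OF paths(1) r(1,2)] by simp
    also have "\<dots> = LS_abs_integral r h a"
      by (rule LS_abs_integral_cong[OF r(1)]) auto
    finally have abs2: "LS_abs_integral t ?hs ?as = LS_abs_integral r h a" .
    have "LS_abs_integral t ?hc a = LS_abs_integral t (\<lambda>s. if s \<le> r then h s else 0) a"
      by (rule LS_abs_integral_cong[OF t(1) hc refl])
    \<comment> \<open>The cut keeps the horizon \<open>t\<close>, so a bound by the given integral
      takes the place of an equality.\<close>
    also have "\<dots> \<le> LS_abs_integral t h a"
      by (rule LS_abs_integral_mono) simp
    finally have abs3: "LS_abs_integral t ?hc a \<le> LS_abs_integral t h a" .
    have int1: "LS_integral t h ?as = LS_integral r h a"
      using LS_integral_cong[OF t(1), of h h ?as "\<lambda>s. a (min s r)"] as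
        LS_integral_stop_integrator[OF paths(1) r(1,2) h] by simp
    \<comment> \<open>The domain is shortened while the integrand is still the stopped one, which
      must therefore be Borel on all of \<open>{0<..t}\<close>.\<close>
    have "LS_integral t ?hs ?as = LS_integral r (\<lambda>s. h (min s r)) a"
      using LS_integral_cong[OF t(1), of ?hs "\<lambda>s. h (min s r)" ?as "\<lambda>s. a (min s r)"] hs as
        LS_integral_stop_integrator[OF paths(1) r(1,2) set_borel_measurable_stop[OF h r(1,2)]] by simp
    also have "\<dots> = LS_integral r h a"
      by (rule LS_integral_cong[OF r(1)]) auto
    finally have int2: "LS_integral t ?hs ?as = LS_integral r h a" .
    have "LS_integral t ?hc a = LS_integral t (\<lambda>s. if s \<le> r then h s else 0) a"
      by (rule LS_integral_cong[OF t(1) hc refl])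
    also have "\<dots> = LS_integral r h a"
      by (rule LS_integral_cut_integrand[OF paths r(1,2)])
    finally have int3: "LS_integral t ?hc a = LS_integral r h a" .
    have "stopped \<tau> (LS_process B H A) (\<omega>, t) = LS_process B H A (\<omega>, min t r)"
      using r(5) t(1) by simp
    also have "\<dots> = LS_integral r h a"
      using r(2) rB by (simp add: LS_process_def h_def[abs_def] a_def[abs_def] min_absorb2)
    finally have int0: "stopped \<tau> (LS_process B H A) (\<omega>, t) = LS_integral r h a" .
    note defs = h_def[abs_def] a_def[abs_def]
    show "LS_abs_integral t (\<lambda>s. H (\<omega>, s)) ?as < top \<and> LS_abs_integral t ?hs ?as < top \<and>
      LS_abs_integral t ?hc (\<lambda>s. A (\<omega>, s)) < top \<and>
      restrict (stopped \<tau> (LS_process B H A)) B (\<omega>, t) = LS_process B H (restrict (stopped \<tau> A) B) (\<omega>, t) \<and>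
      LS_process B H (restrict (stopped \<tau> A) B) (\<omega>, t) =
        LS_process B (restrict (stopped \<tau> H) B) (restrict (stopped \<tau> A) B) (\<omega>, t) \<and>
      LS_process B (restrict (stopped \<tau> H) B) (restrict (stopped \<tau> A) B) (\<omega>, t) =
        LS_process B (restrict (cut H (stoch_Icc M (\<lambda>_. 0) \<tau>)) B) A (\<omega>, t)"
    proof (intro conjI)
      show "LS_abs_integral t (\<lambda>s. H (\<omega>, s)) ?as < top"
        using abs1 fin'(1) unfolding defs by simp
      show "LS_abs_integral t ?hs ?as < top" using abs2 fin'(1) by simp
      show "LS_abs_integral t ?hc (\<lambda>s. A (\<omega>, s)) < top"
        using le_less_trans[OF abs3 fin'(2)] unfolding defs .
      have "restrict (stopped \<tau> (LS_process B H A)) B (\<omega>, t) = LS_integral r h a"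
        using int0 tB by simp
      moreover have "LS_process B H (restrict (stopped \<tau> A) B) (\<omega>, t) = LS_integral r h a"
        using int1 tB unfolding LS_process_def defs by simp
      moreover have "LS_process B (restrict (stopped \<tau> H) B) (restrict (stopped \<tau> A) B) (\<omega>, t) = LS_integral r h a"
        using int2 tB unfolding LS_process_def by simp
      moreover have "LS_process B (restrict (cut H (stoch_Icc M (\<lambda>_. 0) \<tau>)) B) A (\<omega>, t) = LS_integral r h a"
        using int3 tB unfolding LS_process_def defs by simp
      ultimately show "restrict (stopped \<tau> (LS_process B H A)) B (\<omega>, t) = LS_process B H (restrict (stopped \<tau> A) B) (\<omega>, t)"
        "LS_process B H (restrict (stopped \<tau> A) B) (\<omega>, t) =
          LS_process B (restrict (stopped \<tau> H) B) (restrict (stopped \<tau> A) B) (\<omega>, t)"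
        "LS_process B (restrict (stopped \<tau> H) B) (restrict (stopped \<tau> A) B) (\<omega>, t) =
          LS_process B (restrict (cut H (stoch_Icc M (\<lambda>_. 0) \<tau>)) B) A (\<omega>, t)"
        by simp_all
    qed
  qed
qed

text \<open>Stopping and cutting preserve the two classes and look only at the past. This is the
  class membership contained in \<open>integrable_on_wrt\<close>.\<close>

lemma localized_stopped_and_cut:
  assumes B: "PSIT M F B" and H: "H \<in> localized M F B (measurable_processes M)"
    and A: "A \<in> localized M F B (fv_processes M)" and \<tau>: "stopping_time_on M F B \<tau>"
  shows "restrict (stopped \<tau> A) B \<in> localized M F B (fv_processes M)"
    "restrict (stopped \<tau> H) B \<in> localized M F B (measurable_processes M)"
    "restrict (cut H (stoch_Icc M (\<lambda>_. 0) \<tau>)) B \<in> localized M F B (measurable_processes M)"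
proof -
  have m: "\<tau> \<in> borel_measurable M"
    using \<tau> is_stopping_time_measurable unfolding stopping_time_on_def by blast
  show "restrict (stopped \<tau> A) B \<in> localized M F B (fv_processes M)"
    by (rule localized_stopped[OF B A stopped_fv_processes[OF _ m]]) (auto simp: fv_processes_def)
  show "restrict (stopped \<tau> H) B \<in> localized M F B (measurable_processes M)"
    by (rule localized_stopped[OF B H stopped_measurable_processes[OF _ m] measurable_processes_sections(1)])
  show "restrict (cut H (stoch_Icc M (\<lambda>_. 0) \<tau>)) B \<in> localized M F B (measurable_processes M)"
    by (rule localized_map[where \<Phi> = "\<lambda>Y. cut Y (stoch_Icc M (\<lambda>_. 0) \<tau>)",
          OF B H cut_measurable_processes[OF _ m] measurable_processes_sections(1)])
       (auto simp: cut_def dest: PSIT_subset[OF B])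
qed

end

theorem theorem3p12:
  fixes M :: "'a measure" and F :: "real \<Rightarrow> 'a measure"
    and B :: "('a \<times> real) set" and H A :: "'a \<times> real \<Rightarrow> real"
  assumes "usual_filtration M F"
    and "PSIT M F B"
    and "H \<in> localized M F B (measurable_processes M)"
    and "A \<in> localized M F B (fv_processes M)"
    and "integrable_on_wrt M F B H A"
  shows "(indistinguishable M (cut (LS_process B H A) (stoch_Icc M (\<lambda>_. 0) (\<lambda>_. 0)))
                              (cut (\<lambda>p. H p * A p) (stoch_Icc M (\<lambda>_. 0) (\<lambda>_. 0))) \<and>
          has_left_limits_on M B (LS_process B H A) \<and>
          eq_on M B (jump (LS_process B H A)) (\<lambda>p. H p * jump A p)) \<and>
         (\<forall>\<tau>. stopping_time_on M F B \<tau> \<longrightarrow>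
            integrable_on_wrt M F B H (restrict (stopped \<tau> A) B) \<and>
            integrable_on_wrt M F B (restrict (stopped \<tau> H) B) (restrict (stopped \<tau> A) B) \<and>
            integrable_on_wrt M F B (restrict (cut H (stoch_Icc M (\<lambda>_. 0) \<tau>)) B) A \<and>
            eq_on M B (restrict (stopped \<tau> (LS_process B H A)) B)
                      (LS_process B H (restrict (stopped \<tau> A) B)) \<and>
            eq_on M B (LS_process B H (restrict (stopped \<tau> A) B))
                      (LS_process B (restrict (stopped \<tau> H) B) (restrict (stopped \<tau> A) B)) \<and>
            eq_on M B (LS_process B (restrict (stopped \<tau> H) B) (restrict (stopped \<tau> A) B))
                      (LS_process B (restrict (cut H (stoch_Icc M (\<lambda>_. 0) \<tau>)) B) A))"
proof -
  interpret usual_filtration M F by fact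
  note B = assms(2) and H = assms(3) and A = assms(4) and int = assms(5)
  show ?thesis
  proof (intro conjI allI impI)
    fix \<tau> assume \<tau>: "stopping_time_on M F B \<tau>"
    note loc = localized_stopped_and_cut[OF B H A \<tau>] and ae = AE_LS_stopped[OF B int \<tau>]
    show "integrable_on_wrt M F B H (restrict (stopped \<tau> A) B)"
      unfolding integrable_on_wrt_def using loc H ae by (auto elim: eventually_mono)
    show "integrable_on_wrt M F B (restrict (stopped \<tau> H) B) (restrict (stopped \<tau> A) B)"
      unfolding integrable_on_wrt_def using loc ae by (auto elim: eventually_mono)
    show "integrable_on_wrt M F B (restrict (cut H (stoch_Icc M (\<lambda>_. 0) \<tau>)) B) A"
      unfolding integrable_on_wrt_def using loc A ae by (auto elim: eventually_mono)
    show "eq_on M B (restrict (stopped \<tau> (LS_process B H A)) B) (LS_process B H (restrict (stopped \<tau> A) B))"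
      by (rule eq_onI, use ae in eventually_elim) blast
    show "eq_on M B (LS_process B H (restrict (stopped \<tau> A) B))
        (LS_process B (restrict (stopped \<tau> H) B) (restrict (stopped \<tau> A) B))"
      by (rule eq_onI, use ae in eventually_elim) blast
    show "eq_on M B (LS_process B (restrict (stopped \<tau> H) B) (restrict (stopped \<tau> A) B))
        (LS_process B (restrict (cut H (stoch_Icc M (\<lambda>_. 0) \<tau>)) B) A)"
      by (rule eq_onI, use ae in eventually_elim) blast
  qed (rule LS_process_at_zero[OF B] LS_process_left_limits_and_jump[OF B int])+
qed

end
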